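(* Let $\omega\ne0$ and $c_0\ne\frac{2\pi\omega}{L}$. Let $(\theta,\rho)$ be a constrained critical point and suppose that $\theta$ describes an elastica. If $\beta$ is such that (a) $\beta$ is convex, or (b) $|\beta'(x)|<2\mu\Big(\frac{2\pi}{2\pi\omega-Lc_0}\Big)^2|\nu-x|$ for all $x\in\mathbb{R}\setminus\{\nu\}$, or (c) $\sup_{\mathbb{R}}|\beta''|<2\mu\Big(\frac{2\pi}{2\pi\omega-Lc_0}\Big)^2$, then $\rho$ is constant. In particular, $(\theta,\rho)$ describes a homogeneous elastica.
   Context: Fixed parameters: $L>0$, $\nu\in\mathbb{R}$, $\mu>0$, $\omega\in\mathbb{Z}$, $c_0\in\mathbb{R}$, and $\beta\in C^\infty(\mathbb{R})$ with $\beta>0$. The energy is $\mathcal{E}_\mu(\theta,\rho)=\frac12\int_0^L\big(\beta(\rho)(\partial_s\theta-c_0)^2+\mu(\partial_s\rho)^2\big)\,\mathrm{d}s$, considered on $$\mathcal{A}=\Big\{(\theta,\rho)\in W^{1,2}(0,L;\mathbb{R}^2):\ \theta(L)-\theta(0)=2\pi\omega,\ \rho(L)=\rho(0),\ \int_0^L\cos\theta\,\mathrm{d}s=\int_0^L\sin\theta\,\mathrm{d}s=0,\ \int_0^L\rho\,\mathrm{d}s=\nu L\Big\}.$$ Let $W^{1,2}_{\mathrm{per}}(0,L;\mathbb{R}^2)=\{u\in W^{1,2}(0,L;\mathbb{R}^2):u(L)=u(0)\}$. A constrained critical point is a critical point of $\mathcal{E}_\mu$ subject to these constraints; equivalently,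 $(\theta,\rho)\in\mathcal{A}$ such that there exist $\lambda_{\theta1},\lambda_{\theta2},\lambda_\rho\in\mathbb{R}$ with $$0=\int_0^L\big(\beta(\rho)(\partial_s\theta-c_0)\partial_sv-\lambda_{\theta1}\sin\theta\,v+\lambda_{\theta2}\cos\theta\,v\big)\,\mathrm{d}s,\qquad 0=\int_0^L\big(\mu\,\partial_s\rho\,\partial_s\sigma+\tfrac12\beta'(\rho)(\partial_s\theta-c_0)^2\sigma+\lambda_\rho\sigma\big)\,\mathrm{d}s$$ for all $(v,\sigma)\in W^{1,2}_{\mathrm{per}}(0,L;\mathbb{R}^2)$. For $(\theta,\rho)\in\mathcal{A}$, $\theta$ describes a (length-constrained) elastica if the curvature $\kappa=\partial_s\theta$ is smooth and satisfies $\partial_s^2\kappa+\frac12\kappa^3-\lambda\kappa=0$ for some $\lambda\in\mathbb{R}$. If further $\rho$ is constant, $(\theta,\rho)$ describes a homogeneous elastica. *)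

theory Defs
  imports "HOL-Analysis.Analysis"
begin

(* Meant for open S, where the iterated derivatives on S depend only on f restricted to S. *)
definition smooth_on :: "real set \<Rightarrow> (real \<Rightarrow> real) \<Rightarrow> bool" where
  "smooth_on S f \<longleftrightarrow> (\<forall>k. \<forall>x\<in>S. (deriv ^^ k) f differentiable (at x))"

definition L2 :: "real \<Rightarrow> (real \<Rightarrow> real) \<Rightarrow> bool" where
  "L2 L f \<longleftrightarrow> set_borel_measurable lebesgue {0..L} f
     \<and> set_integrable lebesgue {0..L} (\<lambda>s. (f s)\<^sup>2)"

(* C^1 functions with compact support in (0,L); smooth test functions give the same weak
   derivatives. *)
definition test_function :: "real \<Rightarrow> (real \<Rightarrow> real) \<Rightarrow> bool" where
  "test_function L \<phi> \<longleftrightarrow> \<phi> C1_differentiable_on UNIV \<and> closure {s. \<phi> s \<noteq> 0} \<subseteq> {0<..<L}"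

definition has_weak_deriv :: "real \<Rightarrow> (real \<Rightarrow> real) \<Rightarrow> (real \<Rightarrow> real) \<Rightarrow> bool" where
  "has_weak_deriv L u g \<longleftrightarrow> L2 L g \<and>
     (\<forall>\<phi>. test_function L \<phi> \<longrightarrow>
        (LINT s:{0..L}|lebesgue. u s * deriv \<phi> s) = - (LINT s:{0..L}|lebesgue. g s * \<phi> s))"

(* The Sobolev space W^{1,2}(0,L). A class of functions is represented by its unique
   representative that is continuous on [0,L], so that the boundary values u(0), u(L) and
   pointwise statements are meaningful; values outside [0,L] are irrelevant. *)
definition W12 :: "real \<Rightarrow> (real \<Rightarrow> real) set" where
  "W12 L = {u. continuous_on {0..L} u \<and> L2 L u \<and> (\<exists>g. has_weak_deriv L u g)}"

definition W12_per :: "real \<Rightarrow> (real \<Rightarrow> real) set" where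
  "W12_per L = {u \<in> W12 L. u L = u 0}"

(* Determined by u only up to null sets; use it only under integrals. *)
definition weak_deriv :: "real \<Rightarrow> (real \<Rightarrow> real) \<Rightarrow> real \<Rightarrow> real" where
  "weak_deriv L u = (SOME g. has_weak_deriv L u g)"

definition admissible ::
    "real \<Rightarrow> real \<Rightarrow> int \<Rightarrow> ((real \<Rightarrow> real) \<times> (real \<Rightarrow> real)) set" where
  "admissible L \<nu> \<omega> = {(\<theta>, \<rho>). \<theta> \<in> W12 L \<and> \<rho> \<in> W12 L
     \<and> \<theta> L - \<theta> 0 = 2 * pi * of_int \<omega> \<and> \<rho> L = \<rho> 0
     \<and> (LINT s:{0..L}|lebesgue. cos (\<theta> s)) = 0
     \<and> (LINT s:{0..L}|lebesgue. sin (\<theta> s)) = 0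
     \<and> (LINT s:{0..L}|lebesgue. \<rho> s) = \<nu> * L}"

(* Critical points of
     (1/2) int_0^L (beta(rho) (theta' - c0)^2 + mu (rho')^2) ds
   on the admissible class, i.e. weak solutions of the Euler-Lagrange equations with
   Lagrange multipliers l1, l2 for the closedness constraints (the integrals of cos theta
   and sin theta) and lr for the mean-value constraint on rho. *)
definition constrained_critical_point ::
    "real \<Rightarrow> real \<Rightarrow> real \<Rightarrow> int \<Rightarrow> real \<Rightarrow> (real \<Rightarrow> real) \<Rightarrow>
     (real \<Rightarrow> real) \<Rightarrow> (real \<Rightarrow> real) \<Rightarrow> bool" where
  "constrained_critical_point L \<nu> \<mu> \<omega> c0 \<beta> \<theta> \<rho> \<longleftrightarrow>
     (\<theta>, \<rho>) \<in> admissible L \<nu> \<omega> \<and>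
     (\<exists>l1 l2 lr. \<forall>v\<in>W12_per L. \<forall>\<sigma>\<in>W12_per L.
        0 = (LINT s:{0..L}|lebesgue.
               \<beta> (\<rho> s) * (weak_deriv L \<theta> s - c0) * weak_deriv L v s
               - l1 * sin (\<theta> s) * v s + l2 * cos (\<theta> s) * v s) \<and>
        0 = (LINT s:{0..L}|lebesgue.
               \<mu> * weak_deriv L \<rho> s * weak_deriv L \<sigma> s
               + 1/2 * deriv \<beta> (\<rho> s) * (weak_deriv L \<theta> s - c0)\<^sup>2 * \<sigma> s + lr * \<sigma> s))"

(* The curvature is the weak derivative of theta; smoothness means that this class of
   functions has a smooth representative kappa on (0,L). *)
definition elastica :: "real \<Rightarrow> (real \<Rightarrow> real) \<Rightarrow> bool" where
  "elastica L \<theta> \<longleftrightarrow> (\<exists>\<kappa>. has_weak_deriv L \<theta> \<kappa> \<and> smooth_on {0<..<L} \<kappa> \<and>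
     (\<exists>l. \<forall>s\<in>{0<..<L}. deriv (deriv \<kappa>) s + 1/2 * (\<kappa> s)^3 - l * \<kappa> s = 0))"

definition homogeneous_elastica :: "real \<Rightarrow> (real \<Rightarrow> real) \<Rightarrow> (real \<Rightarrow> real) \<Rightarrow> bool" where
  "homogeneous_elastica L \<theta> \<rho> \<longleftrightarrow> elastica L \<theta> \<and> \<rho> constant_on {0..L}"

end

theory Submission
  imports Defs
begin

text \<open>
  A closed planar elastica with nonzero turning number is a circle, so \<open>\<kappa> = 2 \<pi> \<omega> / L\<close>. Writing
  \<open>k = \<kappa> - c\<^sub>0\<close>, the second Euler--Lagrange equation becomes the semilinear equation
  \<open>\<mu> \<rho>'' = k\<^sup>2 \<beta>'(\<rho>) / 2 + \<lambda>\<close> with periodic boundary conditions. Testing it with \<open>\<rho> - \<nu>\<close> gives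
  \<open>\<mu> \<integral> \<rho>'\<^sup>2 = - k\<^sup>2/2 \<integral> (\<beta>'(\<rho>) - b) (\<rho> - \<nu>)\<close> for every constant \<open>b\<close>, since \<open>\<rho> - \<nu>\<close> has mean zero.
  In each of the cases (a), (b), (c) a suitable \<open>b\<close> makes the right-hand side strictly smaller than
  \<open>\<mu> (2 \<pi> / L)\<^sup>2 \<integral> (\<rho> - \<nu>)\<^sup>2\<close> unless \<open>\<rho> = \<nu>\<close>, which contradicts Wirtinger's inequality.
\<close>

section \<open>Test functions and weak derivatives\<close>

text \<open>The thresholds in (b) and (c) are tuned to the spectrum: 2 pi \<omega> - L c0 = L k, so
  k^2/2 times the threshold is \<mu> (2 pi / L)^2, the first nonzero eigenvalue of -\<mu> d^2/ds^2
  on periodic functions. The constant b is \<beta>'(\<nu>) in (a) and (c), where convexity or the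
  mean value theorem controls \<beta>'(x) - \<beta>'(\<nu>), and 0 in (b), which bounds \<beta>'
  itself.

  The obstacle is the lack of regularity at the ends of the interval: critical points are given
  weakly, and the curvature of an elastica is smooth on the open interval only. The du Bois-Reymond
  lemma turns weak derivatives into classical ones inside, and \<kappa> and \<rho>' get continuous
  versions on [0,L] as indefinite integrals plus constants. That \<kappa> takes equal values at both
  ends is a consequence of closedness: \<kappa>' is a linear combination of cos \<theta> and sin
  \<theta>, whose integrals vanish. For \<rho> the equation is tested with \<rho> itself, so that no
  boundary values of \<rho>' appear.\<close>

lemma AE_zero_of_Ioi_integrals:
  fixes f :: "real \<Rightarrow> real"
  assumes f: "integrable lebesgue f"
    and zero: "\<And>x. (LINT y|lebesgue. indicator {x<..} y * f y) = 0"
  shows "AE x in lebesgue. f x = 0"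
proof -
  obtain g where g[measurable]: "g \<in> borel_measurable lborel" and fg: "AE x in lborel. f x = g x"
    using completion_ex_borel_measurable_real[of f lborel] f by auto
  have fg': "AE x in lebesgue. f x = g x"
    using fg by (simp add: AE_completion)
  have [measurable]: "g \<in> borel_measurable lebesgue" "f \<in> borel_measurable lebesgue"
    using measurable_completion[OF g] f by auto
  have "integrable lebesgue g"
    using integrable_cong_AE_imp[OF f _ fg'] measurable_completion[OF g] by auto
  then have ig: "integrable lborel g"
    by (simp add: integrable_completion)
  \<comment> \<open>The positive and negative parts of the Borel version g serve as densities of two
    measures. They agree on all rays and are finite there, hence are equal, and equal measures have
    almost everywhere equal densities.\<close>
  let ?M = "density lborel (\<lambda>x. ennreal (g x))" and ?N = "density lborel (\<lambda>x. ennreal (- g x))"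
  have fin: "(\<integral>\<^sup>+y. ennreal (g y) * indicator {x<..} y \<partial>lborel) < \<infinity>"
      "(\<integral>\<^sup>+y. ennreal (- g y) * indicator {x<..} y \<partial>lborel) < \<infinity>"
      "(\<integral>\<^sup>+y. ennreal (g y) * indicator {x<..} y \<partial>lborel)
        = (\<integral>\<^sup>+y. ennreal (- g y) * indicator {x<..} y \<partial>lborel)" for x
  proof -
    let ?g = "\<lambda>y. indicator {x<..} y * g y"
    have int: "integrable lborel ?g"
      using integrable_real_mult_indicator[OF _ ig, of "{x<..}"] by (simp add: mult.commute)
    have "integral\<^sup>L lborel ?g = (LINT y|lebesgue. ?g y)"
      by (rule integral_completion[symmetric]) measurable
    also have "\<dots> = (LINT y|lebesgue. indicator {x<..} y * f y)"
    proof (rule integral_cong_AE)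
      show "AE y in lebesgue. ?g y = indicator {x<..} y * f y"
        using fg' by eventually_elim simp
    qed (intro borel_measurable_times borel_measurable_indicator; simp)+
    finally have z: "integral\<^sup>L lborel ?g = 0" using zero by simp
    have e: "ennreal (?g y) = ennreal (g y) * indicator {x<..} y"
       "ennreal (- ?g y) = ennreal (- g y) * indicator {x<..} y" for y
      by (auto split: split_indicator)
    have p: "(\<integral>\<^sup>+y. ennreal (?g y) \<partial>lborel) < \<infinity>" "(\<integral>\<^sup>+y. ennreal (- ?g y) \<partial>lborel) < \<infinity>"
      using int unfolding real_integrable_def by (auto simp: top.not_eq_extremum)
    have "enn2real (\<integral>\<^sup>+y. ennreal (?g y) \<partial>lborel) = enn2real (\<integral>\<^sup>+y. ennreal (- ?g y) \<partial>lborel)"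
      using real_lebesgue_integral_def[OF int] z by simp
    then have "(\<integral>\<^sup>+y. ennreal (?g y) \<partial>lborel) = (\<integral>\<^sup>+y. ennreal (- ?g y) \<partial>lborel)"
      using p by (metis ennreal_enn2real infinity_ennreal_def)
    then show "(\<integral>\<^sup>+y. ennreal (g y) * indicator {x<..} y \<partial>lborel) < \<infinity>"
      "(\<integral>\<^sup>+y. ennreal (- g y) * indicator {x<..} y \<partial>lborel) < \<infinity>"
      "(\<integral>\<^sup>+y. ennreal (g y) * indicator {x<..} y \<partial>lborel)
        = (\<integral>\<^sup>+y. ennreal (- g y) * indicator {x<..} y \<partial>lborel)"
      using p unfolding e by auto
  qed
  have "?M = ?N"
    by (rule measure_eqI_lessThan) (use fin in \<open>auto simp: emeasure_density\<close>)
  then have "AE x in lborel. ennreal (g x) = ennreal (- g x)"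
    by (intro sigma_finite_measure.density_unique[OF sigma_finite_lborel]) auto
  then have "AE x in lborel. g x = 0"
  proof eventually_elim
    case (elim x)
    then show ?case
      by (cases "g x \<ge> 0") (auto simp: ennreal_neg ennreal_eq_0_iff dest: sym)
  qed
  then have "AE x in lebesgue. g x = 0"
    by (simp add: AE_completion)
  with fg' show ?thesis by eventually_elim simp
qed

section \<open>Continuously differentiable cut-offs and test functions\<close>

lemma max_0_square_deriv:
  "((\<lambda>x::real. (max 0 x)\<^sup>2) has_real_derivative 2 * max 0 x) (at x)"
proof -
  consider "x < 0" | "x = 0" | "x > 0" by linarith
  then show ?thesis
  proof cases
    case 1
    show ?thesis
      by (rule has_field_derivative_transform_within_open[of "\<lambda>_. 0" _ _ "{..<0}"])
         (use 1 in \<open>auto simp: max_def\<close>)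
  next
    case 3
    show ?thesis
      by (rule has_field_derivative_transform_within_open[of "\<lambda>x. x\<^sup>2" _ _ "{0<..}"])
         (use 3 in \<open>auto simp: max_def intro!: derivative_eq_intros\<close>)
  next
    case 2
    have "((\<lambda>y::real. (max 0 y)\<^sup>2 / y) \<longlongrightarrow> 0) (at 0)"
      by (rule Lim_null_comparison[of _ "\<lambda>y. \<bar>y\<bar>"])
         (auto simp: max_def power2_eq_square intro!: tendsto_eq_intros)
    then show ?thesis
      using 2 by (simp add: has_field_derivative_iff)
  qed
qed

text \<open>Squaring the positive part smooths the kink at 0 to class C^1; the denominator keeps the
  values in [0,1] and makes the limit at infinity 1.\<close>

definition C1_step :: "real \<Rightarrow> real" where
  "C1_step x = (max 0 x)\<^sup>2 / (1 + (max 0 x)\<^sup>2)"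

lemma C1_step_deriv:
  "(C1_step has_real_derivative 2 * max 0 x / (1 + (max 0 x)\<^sup>2)\<^sup>2) (at x)"
proof -
  have "1 + (max 0 x)\<^sup>2 > 0"
    by (simp add: add_pos_nonneg)
  then have "((\<lambda>x. (max 0 x)\<^sup>2 / (1 + (max 0 x)\<^sup>2)) has_real_derivative
     (2 * max 0 x * (1 + (max 0 x)\<^sup>2) - (max 0 x)\<^sup>2 * (0 + 2 * max 0 x))
       / ((1 + (max 0 x)\<^sup>2) * (1 + (max 0 x)\<^sup>2))) (at x)"
    by (intro DERIV_divide DERIV_add DERIV_const max_0_square_deriv) auto
  then show ?thesis
    unfolding C1_step_def[abs_def] by (simp add: algebra_simps power2_eq_square)
qed

lemma C1_step_bounds: "0 \<le> C1_step x" "C1_step x \<le> 1"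
  using add_pos_nonneg[OF zero_less_one zero_le_power2[of "max 0 x"]]
  by (auto simp: C1_step_def field_simps)

lemma C1_step_pos: "x > 0 \<Longrightarrow> C1_step x > 0"
  by (simp add: C1_step_def add_pos_nonneg)

lemma C1_step_eq_0: "x \<le> 0 \<Longrightarrow> C1_step x = 0"
  by (simp add: C1_step_def)

lemma C1_step_tendsto: "(C1_step \<longlongrightarrow> 1) at_top"
proof -
  have *: "((\<lambda>x::real. x\<^sup>2 / (1 + x\<^sup>2)) \<longlongrightarrow> 1) at_top"
  proof -
    have "((\<lambda>x::real. 1 - inverse (1 + x\<^sup>2)) \<longlongrightarrow> 1 - 0) at_top"
      by (intro tendsto_diff tendsto_const tendsto_inverse_0_at_top filterlim_tendsto_add_at_top
          filterlim_pow_at_top filterlim_ident) auto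
    moreover have "1 - inverse (1 + x\<^sup>2) = x\<^sup>2 / (1 + x\<^sup>2)" for x :: real
      using zero_le_power2[of x] by (simp add: field_simps add_nonneg_eq_0_iff)
    ultimately show ?thesis by simp
  qed
  show ?thesis
    by (rule Lim_transform_eventually[OF *])
       (use eventually_ge_at_top[of 0] in eventually_elim, auto simp: C1_step_def)
qed

lemma test_functionI:
  assumes D: "\<And>x. (\<phi> has_real_derivative D x) (at x)" and "continuous_on UNIV D"
    and "0 < a" "b < L" "\<And>s. \<phi> s \<noteq> 0 \<Longrightarrow> a \<le> s \<and> s \<le> b"
  shows "test_function L \<phi>"
proof -
  have "closure {s. \<phi> s \<noteq> 0} \<subseteq> {a..b}"
    by (rule closure_minimal) (use assms in auto)
  also have "\<dots> \<subseteq> {0<..<L}" using assms by auto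
  finally show ?thesis
    using assms unfolding test_function_def C1_differentiable_on_def
    by (auto simp flip: has_real_derivative_iff_has_vector_derivative)
qed

lemma test_functionE:
  assumes "test_function L \<phi>" "L > 0"
  obtains a b where "\<And>x. (\<phi> has_real_derivative deriv \<phi> x) (at x)"
    "continuous_on UNIV (deriv \<phi>)" "0 < a" "a < b" "b < L" "\<And>s. \<phi> s \<noteq> 0 \<Longrightarrow> a \<le> s \<and> s \<le> b"
proof -
  obtain D where D: "\<And>x. (\<phi> has_real_derivative D x) (at x)" and "continuous_on UNIV D"
    using assms unfolding test_function_def C1_differentiable_on_def
    by (auto simp flip: has_real_derivative_iff_has_vector_derivative)
  moreover have "deriv \<phi> = D" using D by (auto intro: DERIV_imp_deriv)
  moreover have "\<exists>a b. 0 < a \<and> a < b \<and> b < L \<and> (\<forall>s. \<phi> s \<noteq> 0 \<longrightarrow> a \<le> s \<and> s \<le> b)"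
  proof (cases "{s. \<phi> s \<noteq> 0} = {}")
    case True
    then show ?thesis using assms(2) by (intro exI[of _ "L/3"] exI[of _ "L/2"]) auto
  next
    case False
    let ?K = "closure {s. \<phi> s \<noteq> 0}"
    have sub: "?K \<subseteq> {0<..<L}" using assms by (simp add: test_function_def)
    have "bounded ?K" by (rule bounded_subset[OF _ sub]) simp
    then have K: "compact ?K" by (simp add: compact_eq_bounded_closed)
    obtain a where a: "a \<in> ?K" "\<forall>y\<in>?K. a \<le> y"
      using compact_attains_inf[OF K] False by auto
    obtain b where b: "b \<in> ?K" "\<forall>y\<in>?K. y \<le> b"
      using compact_attains_sup[OF K] False by auto
    have "0 < a" "b < L" using a b sub by auto
    moreover have "a \<le> s \<and> s \<le> b" if "\<phi> s \<noteq> 0" for s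
      using that a(2) b(2) closure_subset[of "{s. \<phi> s \<noteq> 0}"] by auto
    moreover have "a \<le> b" using a(1) b(2) by blast
    \<comment> \<open>Only a \<le> b is known at this point; halving a makes the inequality strict
      and keeps the left end positive.\<close>
    ultimately have "0 < a/2 \<and> a/2 < b \<and> b < L \<and> (\<forall>s. \<phi> s \<noteq> 0 \<longrightarrow> a/2 \<le> s \<and> s \<le> b)"
      by fastforce
    then show ?thesis by blast
  qed
  ultimately show thesis using that by blast
qed

text \<open>Passes from the Lebesgue integrals of the definitions to gauge integrals, to which the
  fundamental theorem of calculus applies, and in the same step exchanges the integrand for one that
  agrees with it almost everywhere.\<close>

lemma LINT_eq_integral_spike:
  fixes f g :: "real \<Rightarrow> real"
  assumes "f absolutely_integrable_on S" "negligible N" "\<And>x. x \<in> S - N \<Longrightarrow> g x = f x"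
  shows "(LINT x:S|lebesgue. g x) = integral S f"
proof -
  have "g absolutely_integrable_on S"
    using absolutely_integrable_spike assms by blast
  then have "(LINT x:S|lebesgue. g x) = integral S g"
    by (rule set_lebesgue_integral_eq_integral)
  also have "\<dots> = integral S f"
    using integral_spike assms by metis
  finally show ?thesis .
qed

lemma absolutely_integrable_mult_continuous:
  fixes f h :: "real \<Rightarrow> real"
  assumes "h absolutely_integrable_on {a..b}" "continuous_on {a..b} f"
  shows "(\<lambda>s. h s * f s) absolutely_integrable_on {a..b}"
proof -
  have "(\<lambda>s. f s * h s) absolutely_integrable_on {a..b}"
    by (rule absolutely_integrable_bounded_measurable_product_real)
       (use assms in \<open>auto intro!: continuous_imp_measurable_on_sets_lebesgue
          compact_imp_bounded compact_continuous_image\<close>)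
  then show ?thesis by (simp add: mult.commute)
qed

lemma test_function_continuous:
  assumes "test_function L \<phi>"
  shows "continuous_on S \<phi>" "continuous_on S (deriv \<phi>)"
proof -
  obtain D where D: "\<And>x. (\<phi> has_real_derivative D x) (at x)" and c: "continuous_on UNIV D"
    using assms unfolding test_function_def C1_differentiable_on_def
    by (auto simp flip: has_real_derivative_iff_has_vector_derivative)
  moreover have "deriv \<phi> = D" using D by (auto intro: DERIV_imp_deriv)
  ultimately show "continuous_on S \<phi>" "continuous_on S (deriv \<phi>)"
    by (auto intro: continuous_on_subset DERIV_continuous_on has_field_derivative_at_within)
qed

text \<open>A C^1 approximation of the indicator of the open interval (a,b). The shift by -1
  confines the support to [a + 1/n, b - 1/n], so that even a = 0 and b = L give a test
  function.\<close>

definition C1_bump :: "real \<Rightarrow> real \<Rightarrow> nat \<Rightarrow> real \<Rightarrow> real" where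
  "C1_bump a b n s = C1_step (real n * (s - a) - 1) * C1_step (real n * (b - s) - 1)"

lemma C1_bump_test_function:
  assumes "0 \<le> a" "b \<le> L" "n > 0"
  shows "test_function L (C1_bump a b n)"
proof (rule test_functionI)
  let ?d = "\<lambda>x::real. 2 * max 0 x / (1 + (max 0 x)\<^sup>2)\<^sup>2"
  let ?D = "\<lambda>s. ?d (real n * (s - a) - 1) * real n * C1_step (real n * (b - s) - 1)
     + (?d (real n * (b - s) - 1) * (- real n)) * C1_step (real n * (s - a) - 1)"
  have 1: "((\<lambda>s. C1_step (real n * (s - a) - 1)) has_real_derivative
      ?d (real n * (s - a) - 1) * real n) (at s)" for s
    by (rule DERIV_chain2[OF C1_step_deriv]) (auto intro!: derivative_eq_intros)
  have 2: "((\<lambda>s. C1_step (real n * (b - s) - 1)) has_real_derivative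
      ?d (real n * (b - s) - 1) * (- real n)) (at s)" for s
    by (rule DERIV_chain2[OF C1_step_deriv]) (auto intro!: derivative_eq_intros)
  show "(C1_bump a b n has_real_derivative ?D s) (at s)" for s
    unfolding C1_bump_def[abs_def] by (rule DERIV_mult[OF 1 2])
  have c: "continuous_on UNIV C1_step"
    by (rule DERIV_continuous_on[OF has_field_derivative_at_within[OF C1_step_deriv]])
  have nz: "(1 + (max 0 x)\<^sup>2)\<^sup>2 \<noteq> 0" for x :: real
    using add_pos_nonneg[OF zero_less_one zero_le_power2[of "max 0 x"]] by simp
  have d: "continuous_on UNIV ?d"
    by (intro continuous_on_divide continuous_intros) (use nz in auto)
  have cd: "continuous_on UNIV (\<lambda>s. ?d (f s))" "continuous_on UNIV (\<lambda>s. C1_step (f s))"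
    if "continuous_on UNIV f" for f :: "real \<Rightarrow> real"
    using continuous_on_compose2[OF d that] continuous_on_compose2[OF c that] by auto
  have l: "continuous_on UNIV (\<lambda>s. real n * (s - a) - 1)" "continuous_on UNIV (\<lambda>s. real n * (b - s) - 1)"
    by (intro continuous_intros)+
  show "continuous_on UNIV ?D"
    by (rule continuous_on_add; rule continuous_on_mult; (rule cd l)?; (rule continuous_on_mult)?;
        (rule cd l continuous_on_const)?; (rule l)?)
  have "1 / real n > 0" using assms by simp
  then show "0 < a + 1 / n" "b - 1 / n < L" using assms by linarith+
  show "a + 1 / n \<le> s \<and> s \<le> b - 1 / n" if "C1_bump a b n s \<noteq> 0" for s
  proof -
    have "\<not> real n * (s - a) - 1 \<le> 0" "\<not> real n * (b - s) - 1 \<le> 0"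
      using that C1_step_eq_0 unfolding C1_bump_def by auto
    then show ?thesis using assms by (auto simp: field_simps)
  qed
qed

lemma C1_bump_tendsto:
  "(\<lambda>n. C1_bump a b n s) \<longlonglongrightarrow> indicator {a<..<b} s"
proof (cases "a < s \<and> s < b")
  case True
  have *: "(\<lambda>n. C1_step (real n * c - 1)) \<longlonglongrightarrow> 1" if "c > 0" for c
  proof (rule filterlim_compose[OF C1_step_tendsto])
    have "filterlim (\<lambda>n. - 1 + real n * c) at_top sequentially"
      by (rule filterlim_tendsto_add_at_top[OF tendsto_const
          filterlim_at_top_mult_tendsto_pos[OF tendsto_const that filterlim_real_sequentially]])
    then show "filterlim (\<lambda>n. real n * c - 1) at_top sequentially" by simp
  qed
  have "(\<lambda>n. C1_bump a b n s) \<longlonglongrightarrow> 1 * 1"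
    unfolding C1_bump_def by (intro tendsto_mult *) (use True in auto)
  then show ?thesis using True by simp
next
  case False
  have "C1_bump a b n s = 0" for n
  proof -
    have "s - a \<le> 0 \<or> b - s \<le> 0" using False by auto
    then have "real n * (s - a) - 1 \<le> 0 \<or> real n * (b - s) - 1 \<le> 0"
      by (smt (verit) mult_nonneg_nonpos of_nat_0_le_iff)
    then show ?thesis by (auto simp: C1_bump_def C1_step_eq_0)
  qed
  then show ?thesis using False by (auto simp: indicator_def)
qed

lemma C1_bump_bounds: "0 \<le> C1_bump a b n s" "C1_bump a b n s \<le> 1"
  using C1_step_bounds by (auto simp: C1_bump_def intro!: mult_le_one mult_nonneg_nonneg)

section \<open>Fundamental lemmas of the calculus of variations\<close>

text \<open>The bumps tend to the indicator of (a,L), so dominated convergence shows that h,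
  extended by 0, integrates to 0 over every ray to the right; these integrals determine h almost
  everywhere.\<close>

lemma negligible_nonzero_of_orthogonal:
  assumes h: "h absolutely_integrable_on {0..L}" and "L > 0"
    and orth: "\<And>\<phi>. test_function L \<phi> \<Longrightarrow> integral {0..L} (\<lambda>s. h s * \<phi> s) = 0"
  shows "negligible {s \<in> {0..L}. h s \<noteq> (0::real)}"
proof -
  let ?f = "\<lambda>s. indicator {0..L} s * h s"
  have f: "integrable lebesgue ?f"
    using h by (simp add: set_integrable_def)
  have "(LINT y|lebesgue. indicator {x<..} y * ?f y) = 0" for x
  proof -
    \<comment> \<open>Cutting the ray at 0 keeps the approximating bumps supported inside (0,L) and
      does not change the integral of h extended by 0.\<close>
    define a where "a = max 0 x"
    let ?g = "\<lambda>s. h s * indicator {a<..<L} s"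
    have lim: "(\<lambda>n. integral {0..L} (\<lambda>s. h s * C1_bump a L (Suc n) s)) \<longlonglongrightarrow> integral {0..L} ?g"
    proof (rule dominated_convergence(2))
      show "(\<lambda>s. h s * C1_bump a L (Suc n) s) integrable_on {0..L}" for n
        by (intro set_lebesgue_integral_eq_integral(1) absolutely_integrable_mult_continuous h
            test_function_continuous(1) C1_bump_test_function) (auto simp: a_def)
      show "(\<lambda>s. \<bar>h s\<bar>) integrable_on {0..L}"
        using h unfolding absolutely_integrable_on_def by simp
      show "norm (h s * C1_bump a L (Suc n) s) \<le> \<bar>h s\<bar>" for n s
        using C1_bump_bounds[of a L "Suc n" s] by (simp add: abs_mult mult_left_le)
      show "(\<lambda>n. h s * C1_bump a L (Suc n) s) \<longlonglongrightarrow> h s * indicator {a<..<L} s" for s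
        using LIMSEQ_Suc[OF C1_bump_tendsto] by (intro tendsto_mult tendsto_const)
    qed
    have "integral {0..L} (\<lambda>s. h s * C1_bump a L (Suc n) s) = 0" for n
      by (intro orth C1_bump_test_function) (auto simp: a_def)
    with lim have z: "integral {0..L} ?g = 0" by (simp add: LIMSEQ_const_iff)
    have "?g absolutely_integrable_on {0..L}"
    proof (rule dominated_convergence_absolutely_integrable)
      show "(\<lambda>s. h s * C1_bump a L (Suc n) s) absolutely_integrable_on {0..L}" for n
        by (intro absolutely_integrable_mult_continuous h
            test_function_continuous(1) C1_bump_test_function) (auto simp: a_def)
      show "(\<lambda>s. \<bar>h s\<bar>) integrable_on {0..L}"
        using h unfolding absolutely_integrable_on_def by simp
      show "norm (h s * indicator {a<..<L} s) \<le> \<bar>h s\<bar>" for s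
        by (auto simp: indicator_def)
      show "(\<lambda>n. h s * C1_bump a L (Suc n) s) \<longlonglongrightarrow> h s * indicator {a<..<L} s" for s
        using LIMSEQ_Suc[OF C1_bump_tendsto] by (intro tendsto_mult tendsto_const)
    qed
    from LINT_eq_integral_spike[OF this, of "{0,L}" "\<lambda>s. indicator {x<..} s * h s"] z
    have "(LINT s:{0..L}|lebesgue. indicator {x<..} s * h s) = 0"
      by (auto simp: a_def indicator_def split: if_splits)
    then show ?thesis
      by (simp add: set_lebesgue_integral_def mult.left_commute)
  qed
  from AE_zero_of_Ioi_integrals[OF f this] have "AE s in lebesgue. ?f s = 0" .
  then obtain N where "N \<in> null_sets lebesgue" "{s. ?f s \<noteq> 0} \<subseteq> N"
    by (fastforce elim!: AE_E3)
  then have "negligible {s. ?f s \<noteq> 0}"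
    using negligible_iff_null_sets negligible_subset by blast
  then show ?thesis
    by (rule negligible_subset) auto
qed

text \<open>A test function with mean zero is the derivative of a test function. Any \<psi> acquires
  mean zero after subtraction of a multiple of one fixed bump b, so H - c is orthogonal to every
  \<psi> once c is the b-weighted mean of H.\<close>

lemma du_bois_reymond:
  assumes H: "H absolutely_integrable_on {0..L}" and "L > 0"
    and orth: "\<And>\<phi>. test_function L \<phi> \<Longrightarrow> integral {0..L} (\<lambda>s. H s * deriv \<phi> s) = 0"
  obtains c :: real where "negligible {s \<in> {0..L}. H s \<noteq> c}"
proof -
  have bump: "test_function L (C1_bump 0 L n)" if "n > 0" for n
    using that by (intro C1_bump_test_function) auto
  \<comment> \<open>With n L \<ge> 4 both factors of the bump have argument at least 1 at the
    midpoint L/2, so the bump is positive there and has nonzero integral.\<close>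
  define n where "n = nat \<lceil>4 / L\<rceil>"
  have "4 / L \<le> real n" unfolding n_def by linarith
  then have n: "real n * L \<ge> 4" "n > 0" using \<open>L > 0\<close>
    by (auto simp: field_simps intro!: Nat.gr0I)
  define b where "b = C1_bump 0 L n"
  have tb: "test_function L b" unfolding b_def using bump n by simp
  have "integral {0..L} b \<noteq> 0"
  proof
    assume "integral {0..L} b = 0"
    then have "b (L/2) = 0"
      using integral_eq_0_iff[of 0 L b] test_function_continuous(1)[OF tb] \<open>L > 0\<close>
        C1_bump_bounds[of 0 L n] unfolding b_def by auto
    then have "C1_step (real n * L / 2 - 1) = 0"
      by (simp add: b_def C1_bump_def mult.assoc)
    moreover have "C1_step (real n * L / 2 - 1) > 0"
      using n by (intro C1_step_pos) simp
    ultimately show False by simp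
  qed
  define J where "J = integral {0..L} b"
  have J: "J \<noteq> 0" using \<open>integral {0..L} b \<noteq> 0\<close> J_def by simp
  define c where "c = integral {0..L} (\<lambda>s. H s * b s) / J"
  have "integral {0..L} (\<lambda>s. (H s - c) * \<psi> s) = 0" if t: "test_function L \<psi>" for \<psi>
  proof -
    \<comment> \<open>With this m the function \<psi> - m b has mean zero, so its antiderivative F
      takes equal values at 0 and L. As F is constant to the left and to the right of both supports,
      F - F 0 has compact support in (0,L).\<close>
    define m where "m = integral {0..L} \<psi> / J"
    let ?\<eta> = "\<lambda>s. \<psi> s - m * b s"
    have c\<eta>: "continuous_on UNIV ?\<eta>"
      by (intro continuous_on_diff continuous_on_mult continuous_on_const test_function_continuous(1)[OF t] test_function_continuous(1)[OF tb])
    have int: "\<psi> integrable_on {0..L}" "b integrable_on {0..L}"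
      by (intro integrable_continuous_real test_function_continuous(1)[OF t] test_function_continuous(1)[OF tb])+
    obtain F where F: "\<And>x. (F has_real_derivative ?\<eta> x) (at x)"
      using einterval_antiderivative[of "-\<infinity>" "\<infinity>" ?\<eta>] c\<eta>
      by (auto simp: continuous_on_eq_continuous_at has_real_derivative_iff_has_vector_derivative)
    let ?\<phi> = "\<lambda>s. F s - F 0"
    have d\<phi>: "(?\<phi> has_real_derivative ?\<eta> x) (at x)" for x
      using F[of x] by (auto intro!: derivative_eq_intros)
    obtain a1 b1 where 1: "0 < a1" "a1 < b1" "b1 < L" "\<And>s. \<psi> s \<noteq> 0 \<Longrightarrow> a1 \<le> s \<and> s \<le> b1"
      using test_functionE[OF t \<open>L > 0\<close>] by metis
    obtain a2 b2 where 2: "0 < a2" "a2 < b2" "b2 < L" "\<And>s. b s \<noteq> 0 \<Longrightarrow> a2 \<le> s \<and> s \<le> b2"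
      using test_functionE[OF tb \<open>L > 0\<close>] by metis
    have "(?\<eta> has_integral F L - F 0) {0..L}"
      by (rule fundamental_theorem_of_calculus)
         (use \<open>L > 0\<close> F in \<open>auto simp flip: has_real_derivative_iff_has_vector_derivative
            intro: has_field_derivative_at_within\<close>)
    moreover have "(?\<eta> has_integral integral {0..L} \<psi> - m * J) {0..L}"
      unfolding J_def by (intro has_integral_diff has_integral_mult_right integrable_integral int)
    ultimately have "F L - F 0 = integral {0..L} \<psi> - m * J"
      by (rule has_integral_unique)
    then have FL: "F L = F 0" using J by (simp add: m_def)
    have F0: "F s = F 0" if "s < min a1 a2" for s
    proof -
      have "(F has_real_derivative 0) (at x within {..<min a1 a2})" if "x \<in> {..<min a1 a2}" for x
      proof -
        have "\<psi> x = 0" "b x = 0" using 1(4)[of x] 2(4)[of x] that by auto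
        then show ?thesis using F[of x] by (simp add: has_field_derivative_at_within)
      qed
      then obtain k where "\<And>x. x \<in> {..<min a1 a2} \<Longrightarrow> F x = k"
        using has_field_derivative_zero_constant[OF convex_real_interval(4)] by metis
      then show "F s = F 0" using that 1 2 by simp
    qed
    have F1: "F s = F L" if "s > max b1 b2" for s
    proof -
      have "(F has_real_derivative 0) (at x within {max b1 b2<..})" if "x \<in> {max b1 b2<..}" for x
      proof -
        have "\<psi> x = 0" "b x = 0" using 1(4)[of x] 2(4)[of x] that by auto
        then show ?thesis using F[of x] by (simp add: has_field_derivative_at_within)
      qed
      then obtain k where "\<And>x. x \<in> {max b1 b2<..} \<Longrightarrow> F x = k"
        using has_field_derivative_zero_constant[OF convex_real_interval(3)] by metis
      then show "F s = F L" using that 1 2 by simp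
    qed
    have t\<phi>: "test_function L ?\<phi>"
    proof (rule test_functionI[OF d\<phi> c\<eta>])
      show "0 < min a1 a2" "max b1 b2 < L" using 1 2 by auto
      show "min a1 a2 \<le> s \<and> s \<le> max b1 b2" if "F s - F 0 \<noteq> 0" for s
        using that F0[of s] F1[of s] FL by fastforce
    qed
    have "deriv ?\<phi> = ?\<eta>" using d\<phi> by (auto intro: DERIV_imp_deriv)
    with orth[OF t\<phi>] have z: "integral {0..L} (\<lambda>s. H s * (\<psi> s - m * b s)) = 0" by simp
    have i: "(\<lambda>s. H s * \<psi> s) integrable_on {0..L}" "(\<lambda>s. H s * b s) integrable_on {0..L}"
      by (intro set_lebesgue_integral_eq_integral(1) absolutely_integrable_mult_continuous H
          test_function_continuous(1)[OF t] test_function_continuous(1)[OF tb])+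
    have "((\<lambda>s. H s * \<psi> s - m * (H s * b s)) has_integral
        integral {0..L} (\<lambda>s. H s * \<psi> s) - m * (c * J)) {0..L}"
      using i J by (intro has_integral_diff has_integral_mult_right) (auto simp: c_def)
    then have "integral {0..L} (\<lambda>s. H s * \<psi> s) = m * (c * J)"
      using z by (simp add: integral_unique algebra_simps)
    moreover have "((\<lambda>s. H s * \<psi> s - c * \<psi> s) has_integral
        integral {0..L} (\<lambda>s. H s * \<psi> s) - c * integral {0..L} \<psi>) {0..L}"
      by (intro has_integral_diff has_integral_mult_right integrable_integral i int)
    ultimately show ?thesis
      using J by (simp add: integral_unique left_diff_distrib m_def)
  qed
  then have "negligible {s \<in> {0..L}. H s - c \<noteq> 0}"
    using H \<open>L > 0\<close> by (intro negligible_nonzero_of_orthogonal)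
      (auto intro!: set_integral_diff(1) absolutely_integrable_on_const)
  then show thesis using that[of c] by simp
qed

section \<open>Weak derivatives and their classical counterparts\<close>

lemma L2_imp_absolutely_integrable:
  assumes "L2 L f"
  shows "f absolutely_integrable_on {0..L}" "(\<lambda>s. (f s)\<^sup>2) absolutely_integrable_on {0..L}"
proof -
  show sq: "(\<lambda>s. (f s)\<^sup>2) absolutely_integrable_on {0..L}"
    using assms by (simp add: L2_def)
  have m: "f \<in> borel_measurable (lebesgue_on {0..L})"
    using assms by (simp add: L2_def set_borel_measurable_def borel_measurable_restrict_space_iff)
  show "f absolutely_integrable_on {0..L}"
  proof (rule measurable_bounded_by_integrable_imp_absolutely_integrable[OF m])
    show "(\<lambda>s. 1 + (f s)\<^sup>2) integrable_on {0..L}"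
      by (intro integrable_add set_lebesgue_integral_eq_integral(1)[OF sq]) auto
    show "norm (f s) \<le> 1 + (f s)\<^sup>2" for s
      using sum_squares_bound[of 1 "\<bar>f s\<bar>"] by (simp add: power2_eq_square)
  qed simp
qed

lemma continuous_imp_L2:
  assumes "continuous_on {0..L} f"
  shows "L2 L f"
proof -
  have "f \<in> borel_measurable (lebesgue_on {0..L})"
    using assms by (intro continuous_imp_measurable_on_sets_lebesgue) auto
  then have "set_borel_measurable lebesgue {0..L} f"
    by (simp add: set_borel_measurable_def borel_measurable_restrict_space_iff)
  moreover have "(\<lambda>s. (f s)\<^sup>2) absolutely_integrable_on {0..L}"
    by (intro absolutely_integrable_continuous_real continuous_intros assms)
  ultimately show ?thesis by (simp add: L2_def)
qed

text \<open>The derivative of G is available only in the interior and g may be merely integrable;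
  the fundamental theorem for continuous functions with interior derivative covers this, and \<phi>
  removes the boundary terms.\<close>

lemma integral_by_parts_test_function:
  assumes G: "continuous_on {0..L} G" and G': "\<And>s. s \<in> {0<..<L} \<Longrightarrow> (G has_real_derivative g s) (at s)"
    and g: "g absolutely_integrable_on {0..L}" and \<phi>: "test_function L \<phi>" and L: "L > 0"
  shows "integral {0..L} (\<lambda>s. G s * deriv \<phi> s) = - integral {0..L} (\<lambda>s. g s * \<phi> s)"
proof -
  obtain a b where d\<phi>: "\<And>x. (\<phi> has_real_derivative deriv \<phi> x) (at x)"
    and ab: "0 < a" "b < L" "\<And>s. \<phi> s \<noteq> 0 \<Longrightarrow> a \<le> s \<and> s \<le> b"
    using test_functionE[OF \<phi> L] by metis
  have ends: "\<phi> 0 = 0" "\<phi> L = 0"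
    using ab(1,2) ab(3)[of 0] ab(3)[of L] by fastforce+
  have "((\<lambda>s. G s * deriv \<phi> s + g s * \<phi> s) has_integral G L * \<phi> L - G 0 * \<phi> 0) {0..L}"
  proof (rule fundamental_theorem_of_calculus_interior)
    show "continuous_on {0..L} (\<lambda>s. G s * \<phi> s)"
      by (intro continuous_on_mult G test_function_continuous(1)[OF \<phi>])
    show "((\<lambda>s. G s * \<phi> s) has_vector_derivative G s * deriv \<phi> s + g s * \<phi> s) (at s)"
      if "s \<in> {0<..<L}" for s
      using DERIV_mult[OF G'[OF that] d\<phi>[of s]]
      by (simp add: has_real_derivative_iff_has_vector_derivative add.commute mult.commute)
  qed (use L in auto)
  then have "integral {0..L} (\<lambda>s. G s * deriv \<phi> s + g s * \<phi> s) = 0"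
    using ends by (simp add: integral_unique)
  moreover have "integral {0..L} (\<lambda>s. G s * deriv \<phi> s + g s * \<phi> s) =
      integral {0..L} (\<lambda>s. G s * deriv \<phi> s) + integral {0..L} (\<lambda>s. g s * \<phi> s)"
    by (intro Henstock_Kurzweil_Integration.integral_add integrable_continuous_real continuous_on_mult G
        test_function_continuous(2)[OF \<phi>] set_lebesgue_integral_eq_integral(1)
        absolutely_integrable_mult_continuous[OF g] test_function_continuous(1)[OF \<phi>])
  ultimately show ?thesis by simp
qed

lemma has_weak_deriv_iff_integral:
  assumes "L2 L u"
  shows "has_weak_deriv L u g \<longleftrightarrow> L2 L g \<and> (\<forall>\<phi>. test_function L \<phi> \<longrightarrow>
    integral {0..L} (\<lambda>s. u s * deriv \<phi> s) = - integral {0..L} (\<lambda>s. g s * \<phi> s))"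
proof -
  have "(LINT s:{0..L}|lebesgue. u s * deriv \<phi> s) = integral {0..L} (\<lambda>s. u s * deriv \<phi> s)"
    "L2 L g \<Longrightarrow> (LINT s:{0..L}|lebesgue. g s * \<phi> s) = integral {0..L} (\<lambda>s. g s * \<phi> s)"
    if "test_function L \<phi>" for \<phi>
    by (intro set_lebesgue_integral_eq_integral(2) absolutely_integrable_mult_continuous
        L2_imp_absolutely_integrable(1) assms test_function_continuous(2)[OF that] test_function_continuous(1)[OF that]; assumption)+
  then show ?thesis unfolding has_weak_deriv_def by auto
qed

lemma has_weak_deriv_classical:
  assumes "continuous_on {0..L} u" "\<And>s. s \<in> {0<..<L} \<Longrightarrow> (u has_real_derivative g s) (at s)"
    and "L2 L g" "L > 0"
  shows "has_weak_deriv L u g"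
  using assms integral_by_parts_test_function[OF assms(1,2) L2_imp_absolutely_integrable(1)]
  by (simp add: has_weak_deriv_iff_integral continuous_imp_L2)

lemma weak_deriv_unique:
  assumes u: "L2 L u" and g: "has_weak_deriv L u g" "has_weak_deriv L u k" and "L > 0"
  shows "negligible {s \<in> {0..L}. g s \<noteq> k s}"
proof -
  have i: "g absolutely_integrable_on {0..L}" "k absolutely_integrable_on {0..L}"
    using g by (auto simp: has_weak_deriv_def L2_imp_absolutely_integrable)
  have "integral {0..L} (\<lambda>s. (g s - k s) * \<phi> s) = 0" if "test_function L \<phi>" for \<phi>
  proof -
    note c = test_function_continuous(1)[OF that]
    have "integral {0..L} (\<lambda>s. g s * \<phi> s) = integral {0..L} (\<lambda>s. k s * \<phi> s)"
      using g that by (auto simp: has_weak_deriv_iff_integral[OF u])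
    moreover have "integral {0..L} (\<lambda>s. g s * \<phi> s - k s * \<phi> s) =
        integral {0..L} (\<lambda>s. g s * \<phi> s) - integral {0..L} (\<lambda>s. k s * \<phi> s)"
      by (intro Henstock_Kurzweil_Integration.integral_diff set_lebesgue_integral_eq_integral(1)
          absolutely_integrable_mult_continuous i c)
    ultimately show ?thesis by (simp add: left_diff_distrib)
  qed
  then have "negligible {s \<in> {0..L}. g s - k s \<noteq> 0}"
    using \<open>L > 0\<close> i by (intro negligible_nonzero_of_orthogonal set_integral_diff(1))
  then show ?thesis by simp
qed

text \<open>\<open>weak_deriv\<close> is a Hilbert choice; this allows any explicit representative
  to replace it under an integral.\<close>

lemma weak_deriv_eq_AE:
  assumes "L2 L u" "has_weak_deriv L u k" "L > 0"
  shows "negligible {s \<in> {0..L}. weak_deriv L u s \<noteq> k s}"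
  using assms weak_deriv_unique[OF assms(1) _ assms(2,3)] someI[of "has_weak_deriv L u" k]
  unfolding weak_deriv_def by blast

lemma has_weak_deriv_cong_AE:
  assumes u: "L2 L u" "has_weak_deriv L u g" and k: "L2 L k"
    and eq: "negligible {s \<in> {0..L}. g s \<noteq> k s}"
  shows "has_weak_deriv L u k"
proof -
  have "integral {0..L} (\<lambda>s. g s * \<phi> s) = integral {0..L} (\<lambda>s. k s * \<phi> s)" for \<phi>
    by (rule integral_spike[OF eq]) auto
  then show ?thesis using assms by (simp add: has_weak_deriv_iff_integral)
qed

lemma negligible_eq_const_imp_eq:
  fixes f :: "real \<Rightarrow> real"
  assumes "continuous_on {0..L} f" and "negligible {s \<in> {0..L}. f s \<noteq> c}" and "L > 0" and "s \<in> {0..L}"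
  shows "f s = c"
proof -
  have "integral {0..L} (\<lambda>s. (f s - c)\<^sup>2) = integral {0..L} (\<lambda>s. 0)"
    by (rule integral_spike[OF assms(2)]) auto
  then have "\<forall>s\<in>{0..L}. (f s - c)\<^sup>2 = 0"
    using integral_eq_0_iff[of 0 L "\<lambda>s. (f s - c)\<^sup>2"] assms(3)
      continuous_on_power[OF continuous_on_diff[OF assms(1) continuous_on_const]] by simp
  then show ?thesis using assms by simp
qed

text \<open>The difference of u and the indefinite integral of g is orthogonal to all derivatives of
  test functions, hence constant. Continuity of g is asked on the open interval only because the
  curvature of an elastica offers no more.\<close>

lemma has_weak_deriv_imp_has_real_derivative:
  assumes u: "continuous_on {0..L} u" and g: "has_weak_deriv L u g"
    and cont: "continuous_on {0<..<L} g" and L: "L > 0"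
  shows "s \<in> {0<..<L} \<Longrightarrow> (u has_real_derivative g s) (at s)"
proof -
  let ?G = "\<lambda>s. integral {0..s} g"
  have ig: "g absolutely_integrable_on {0..L}"
    using g by (auto simp: has_weak_deriv_def L2_imp_absolutely_integrable)
  then have i: "g integrable_on {0..L}" by (rule set_lebesgue_integral_eq_integral(1))
  have G: "continuous_on {0..L} ?G" by (rule indefinite_integral_continuous_1[OF i])
  have G': "(?G has_real_derivative g s) (at s)" if s: "s \<in> {0<..<L}" for s
  proof -
    have "continuous (at s) g"
      using cont s by (simp add: continuous_on_eq_continuous_at)
    then have "(?G has_vector_derivative g s) (at s within {0..L} - {})"
      using integral_has_vector_derivative_continuous_at[OF i, of s "{}"] s
        continuous_at_imp_continuous_at_within by fastforce
    moreover have "at s within {0..L} - {} = at s"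
      using s by (intro at_within_interior) (simp add: interior_atLeastAtMost_real)
    ultimately show ?thesis by (simp add: has_real_derivative_iff_has_vector_derivative)
  qed
  have c: "continuous_on {0..L} (\<lambda>s. u s - ?G s)" by (intro continuous_on_diff u G)
  have orth: "integral {0..L} (\<lambda>s. (u s - ?G s) * deriv \<phi> s) = 0" if "test_function L \<phi>" for \<phi>
  proof -
    note c\<phi> = test_function_continuous(2)[OF that]
    have "integral {0..L} (\<lambda>s. u s * deriv \<phi> s - ?G s * deriv \<phi> s) =
        integral {0..L} (\<lambda>s. u s * deriv \<phi> s) - integral {0..L} (\<lambda>s. ?G s * deriv \<phi> s)"
      by (intro Henstock_Kurzweil_Integration.integral_diff integrable_continuous_real
          continuous_on_mult u G c\<phi>)
    also have "\<dots> = 0"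
      using g that integral_by_parts_test_function[OF G G' ig that L]
      by (simp add: has_weak_deriv_iff_integral continuous_imp_L2 u)
    finally show ?thesis by (simp add: left_diff_distrib)
  qed
  obtain c where n: "negligible {s \<in> {0..L}. u s - ?G s \<noteq> c}"
    by (rule du_bois_reymond[OF absolutely_integrable_continuous_real[OF c] L orth])
  have eq: "u s = ?G s + c" if "s \<in> {0..L}" for s
    using negligible_eq_const_imp_eq[OF c n L that] by simp
  show "(u has_real_derivative g s) (at s)" if s: "s \<in> {0<..<L}"
  proof (rule has_field_derivative_transform_within_open[of "\<lambda>s. ?G s + c" _ _ "{0<..<L}"])
    show "((\<lambda>s. ?G s + c) has_real_derivative g s) (at s)"
      using G'[OF s] by (auto intro!: derivative_eq_intros)
  qed (use s eq in auto)
qed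

text \<open>The weak form of u'' = q. If Q is the indefinite integral of q, integration by parts
  makes g - Q orthogonal to all derivatives of test functions, so g equals Q plus a constant almost
  everywhere. This representative is continuous up to the endpoints.\<close>

lemma weak_solution_regularity:
  assumes u: "continuous_on {0..L} u" and g: "has_weak_deriv L u g"
    and q: "continuous_on {0..L} q" and L: "L > 0"
    and weak: "\<And>\<phi>. test_function L \<phi> \<Longrightarrow> integral {0..L} (\<lambda>s. g s * deriv \<phi> s + q s * \<phi> s) = 0"
  obtains r where "continuous_on {0..L} r" "negligible {s \<in> {0..L}. g s \<noteq> r s}"
    "\<And>s. s \<in> {0<..<L} \<Longrightarrow> (u has_real_derivative r s) (at s)"
proof -
  let ?Q = "\<lambda>s. integral {0..s} q"
  have ig: "g absolutely_integrable_on {0..L}"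
    using g by (auto simp: has_weak_deriv_def L2_imp_absolutely_integrable)
  have Q: "continuous_on {0..L} ?Q"
    by (intro indefinite_integral_continuous_1 integrable_continuous_real q)
  have Q': "(?Q has_real_derivative q s) (at s)" if s: "s \<in> {0<..<L}" for s
  proof -
    have "(?Q has_real_derivative q s) (at s within {0..L})"
      using s by (intro integral_has_real_derivative q) auto
    moreover have "at s within {0..L} = at s"
      using s by (intro at_within_interior) (simp add: interior_atLeastAtMost_real)
    ultimately show ?thesis by simp
  qed
  have orth: "integral {0..L} (\<lambda>s. (g s - ?Q s) * deriv \<phi> s) = 0" if t: "test_function L \<phi>" for \<phi>
  proof -
    note c = test_function_continuous[OF t]
    have i: "(\<lambda>s. g s * deriv \<phi> s) integrable_on {0..L}"
      by (intro set_lebesgue_integral_eq_integral(1) absolutely_integrable_mult_continuous ig c)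
    have i2: "(\<lambda>s. q s * \<phi> s) integrable_on {0..L}" "(\<lambda>s. ?Q s * deriv \<phi> s) integrable_on {0..L}"
      by (intro integrable_continuous_real continuous_on_mult c Q q)+
    have "integral {0..L} (\<lambda>s. g s * deriv \<phi> s - ?Q s * deriv \<phi> s) =
        integral {0..L} (\<lambda>s. g s * deriv \<phi> s) - integral {0..L} (\<lambda>s. ?Q s * deriv \<phi> s)"
      by (intro Henstock_Kurzweil_Integration.integral_diff i i2)
    also have "\<dots> = integral {0..L} (\<lambda>s. g s * deriv \<phi> s) + integral {0..L} (\<lambda>s. q s * \<phi> s)"
      using integral_by_parts_test_function[OF Q Q' absolutely_integrable_continuous_real[OF q] t L] by simp
    also have "\<dots> = integral {0..L} (\<lambda>s. g s * deriv \<phi> s + q s * \<phi> s)"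
      by (intro Henstock_Kurzweil_Integration.integral_add[symmetric] i i2)
    also have "\<dots> = 0" by (rule weak[OF t])
    finally show ?thesis by (simp add: left_diff_distrib)
  qed
  have "(\<lambda>s. g s - ?Q s) absolutely_integrable_on {0..L}"
    by (intro set_integral_diff(1) ig absolutely_integrable_continuous_real Q)
  then obtain c where n: "negligible {s \<in> {0..L}. g s - ?Q s \<noteq> c}"
    by (rule du_bois_reymond[OF _ L orth])
  let ?r = "\<lambda>s. ?Q s + c"
  have r: "continuous_on {0..L} ?r" by (intro continuous_intros Q)
  have n': "negligible {s \<in> {0..L}. g s \<noteq> ?r s}"
    by (rule negligible_subset[OF n]) auto
  have "has_weak_deriv L u ?r"
    by (rule has_weak_deriv_cong_AE[OF continuous_imp_L2[OF u] g continuous_imp_L2[OF r] n'])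
  then show thesis
    using that[OF r n'] has_weak_deriv_imp_has_real_derivative[OF u _ continuous_on_subset[OF r] L] by force
qed

section \<open>Wirtinger's inequality\<close>

lemma sin_scaled_eq_0_iff:
  fixes L :: real
  assumes "L > 0"
  shows "sin (2 * pi / L * t) = 0 \<longleftrightarrow> (\<exists>k::int. t = of_int k * (L / 2))"
  unfolding sin_zero_iff_int2
proof (intro ex_cong1)
  show "2 * pi / L * t = of_int k * pi \<longleftrightarrow> t = of_int k * (L / 2)" for k :: int
    using assms by (auto simp: field_simps)
qed

text \<open>True at the poles as well, where division by zero makes both sides 0. It moves any pole,
  and a neighbourhood of it, to the origin.\<close>

lemma cot_int_pi_shift: "cot (x + of_int k * pi) = cot (x::real)"
proof -
  have "sin (of_int k * pi) = 0" by (simp add: sin_zero_iff_int2)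
  then have s: "sin (x + of_int k * pi) = sin x * cos (of_int k * pi)"
      "cos (x + of_int k * pi) = cos x * cos (of_int k * pi)"
    by (auto simp: sin_add cos_add)
  have "(cos (of_int k * pi))\<^sup>2 = (1::real)"
    using sin_cos_squared_add[of "of_int k * pi"] \<open>sin (of_int k * pi) = 0\<close> by simp
  then have "cos (of_int k * pi) \<noteq> (0::real)" by auto
  then show ?thesis unfolding cot_def s by simp
qed

text \<open>The pole of cot at 0 is simple, so a factor vanishing to second order suppresses it. In
  Wirtinger's inequality that factor is the square of a Lipschitz function with a zero at the
  pole.\<close>

lemma square_mult_cot_tendsto_0:
  fixes w :: real
  assumes "w > 0"
  shows "((\<lambda>t. t\<^sup>2 * cot (w * t)) \<longlongrightarrow> 0) (at 0)"
proof -
  have "((\<lambda>t. sin (w * t)) has_real_derivative cos (w * 0) * w) (at 0)"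
    by (auto intro!: derivative_eq_intros)
  then have "((\<lambda>t. sin (w * t) / t) \<longlongrightarrow> w) (at 0)"
    by (simp add: has_field_derivative_iff)
  then have "((\<lambda>t. t * cos (w * t) * inverse (sin (w * t) / t)) \<longlongrightarrow> 0 * cos (w * 0) * inverse w) (at 0)"
    by (intro tendsto_intros) (use assms in auto)
  then show ?thesis
    by (simp add: cot_def power2_eq_square mult_ac)
qed

lemma lipschitz_of_bounded_derivative:
  fixes h :: "real \<Rightarrow> real"
  assumes h: "continuous_on {a..b} h" and h': "\<And>s. s \<in> {a<..<b} \<Longrightarrow> (h has_real_derivative r s) (at s)"
    and B: "\<And>s. s \<in> {a..b} \<Longrightarrow> \<bar>r s\<bar> \<le> B" and s: "s \<in> {a..b}" "t \<in> {a..b}"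
  shows "\<bar>h s - h t\<bar> \<le> B * \<bar>s - t\<bar>"
proof -
  have *: "\<bar>h y - h x\<bar> \<le> B * (y - x)" if "x < y" "x \<in> {a..b}" "y \<in> {a..b}" for x y
  proof -
    obtain l z where z: "x < z" "z < y" "DERIV h z :> l" "h y - h x = (y - x) * l"
    proof -
      have "continuous_on {x..y} h"
        by (rule continuous_on_subset[OF h]) (use \<open>x \<in> {a..b}\<close> \<open>y \<in> {a..b}\<close> in auto)
      moreover have "h differentiable (at z)" if "x < z" "z < y" for z
        using h'[of z] that \<open>x \<in> {a..b}\<close> \<open>y \<in> {a..b}\<close> by (auto simp: real_differentiable_def)
      ultimately show thesis using MVT[OF \<open>x < y\<close>, of h] that by blast
    qed
    then have "l = r z" using h'[of z] that DERIV_unique by (metis atLeastAtMost_iff greaterThanLessThan_iff less_le_trans le_less_trans)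
    then have "\<bar>l\<bar> \<le> B" using B z that by auto
    then show ?thesis using z that by (simp add: abs_mult mult.commute mult_left_mono)
  qed
  show ?thesis
    using *[of s t] *[of t s] s by (cases s t rule: linorder_cases) (auto simp: abs_minus_commute)
qed

text \<open>
  Subtracting the common value of \<open>f\<close> at two points \<open>c\<close>, \<open>c + L/2\<close> reduces the inequality to
  functions \<open>h\<close> vanishing at the zeros of \<open>sin (w (s - c))\<close>. For those,
  \<open>h'\<^sup>2 - w\<^sup>2 h\<^sup>2 = (h' - w h cot)\<^sup>2 + (w h\<^sup>2 cot)'\<close>, and \<open>w h\<^sup>2 cot\<close> is continuous because
  Isabelle's \<open>cot\<close> is \<open>0\<close> at its poles.
\<close>
lemma wirtinger_inequality:
  fixes f r :: "real \<Rightarrow> real"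
  assumes L: "L > 0" and f: "continuous_on {0..L} f" and r: "continuous_on {0..L} r"
    and f': "\<And>s. s \<in> {0<..<L} \<Longrightarrow> (f has_real_derivative r s) (at s)"
    and per: "f L = f 0" and mean: "integral {0..L} f = 0"
  shows "(2 * pi / L)\<^sup>2 * integral {0..L} (\<lambda>s. (f s)\<^sup>2) \<le> integral {0..L} (\<lambda>s. (r s)\<^sup>2)"
proof -
  define w where "w = 2 * pi / L"
  have w: "w > 0" using L by (simp add: w_def)
  obtain c where c: "0 \<le> c" "c \<le> L/2" and fc: "f c = f (c + L/2)"
  proof -
    \<comment> \<open>Periodicity gives \<open>?d\<close> opposite values at 0 and L/2, so the
      intermediate value theorem yields a zero.\<close>
    let ?d = "\<lambda>x. f x - f (x + L/2)"
    have cont: "continuous_on {0..L/2} ?d"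
      by (intro continuous_intros continuous_on_compose2[OF f] continuous_on_subset[OF f]) (use L in auto)
    have "?d 0 = - ?d (L/2)" using per by simp
    then consider "?d 0 \<le> 0" "0 \<le> ?d (L/2)" | "?d (L/2) \<le> 0" "0 \<le> ?d 0" by linarith
    then have "\<exists>x\<ge>0. x \<le> L/2 \<and> ?d x = 0"
      using IVT'[of ?d 0 0 "L/2", OF _ _ _ cont] IVT2'[of ?d "L/2" 0 0, OF _ _ _ cont] L by cases auto
    then show thesis using that by auto
  qed
  define a where "a = f c"
  define h where "h s = f s - a" for s
  have h: "continuous_on {0..L} h" unfolding h_def[abs_def] by (intro continuous_intros f)
  have h': "(h has_real_derivative r s) (at s)" if "s \<in> {0<..<L}" for s
    unfolding h_def[abs_def] using f'[OF that] by (auto intro!: derivative_eq_intros)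
  have hc: "h c = 0" "h (c + L/2) = 0" using fc by (auto simp: h_def a_def)
  have hper: "h L = h 0" using per by (simp add: h_def)
  obtain B where B: "\<And>s. s \<in> {0..L} \<Longrightarrow> \<bar>r s\<bar> \<le> B"
    using compact_imp_bounded[OF compact_continuous_image[OF r]] unfolding bounded_iff by force
  have lip: "\<bar>h s - h t\<bar> \<le> B * \<bar>s - t\<bar>" if "s \<in> {0..L}" "t \<in> {0..L}" for s t
    by (rule lipschitz_of_bounded_derivative[OF h _ B that]) (rule h')
  have zero: "\<exists>k::int. s = c + of_int k * (L/2)" if z: "sin (w * (s - c)) = 0" for s
  proof -
    obtain k :: int where "s - c = of_int k * (L/2)"
      using z sin_scaled_eq_0_iff[OF L, of "s - c"] unfolding w_def by blast
    then show ?thesis by (intro exI[of _ k]) simp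
  qed
  have h0: "h s = 0" if z: "sin (w * (s - c)) = 0" and s: "s \<in> {0..L}" for s
  proof -
    obtain k :: int where k: "s = c + of_int k * (L/2)" using zero[OF z] by blast
    have e: "of_int k * (L/2) = s - c" using k by simp
    have "of_int k * (L/2) \<ge> (-1) * (L/2)" "of_int k * (L/2) \<le> 2 * (L/2)"
      unfolding e using s c L by auto
    then have "real_of_int k \<ge> -1" "real_of_int k \<le> 2"
      using mult_right_le_imp_le[of _ "L/2"] L by (metis half_gt_zero)+
    \<comment> \<open>Each extreme case is confined to an endpoint: k = -1 forces s = 0 and c = L/2,
      while k = 2 forces s = L and c = 0. Periodicity of h then transfers the value from the other
      endpoint.\<close>
    then have "k = -1 \<or> k = 0 \<or> k = 1 \<or> k = 2" by linarith
    then show ?thesis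
    proof (elim disjE)
      assume "k = -1"
      then have "s = 0" "c + L/2 = L" using k s c by auto
      then show ?thesis using hc hper by metis
    next
      assume "k = 2"
      then have "s = L" "c = 0" using k s c by auto
      then show ?thesis using hc hper by simp
    qed (use k hc in auto)
  qed
  define P where "P s = w * (h s)\<^sup>2 * cot (w * (s - c))" for s
  have contP: "continuous_on {0..L} P"
    unfolding continuous_on_eq_continuous_within
  proof
    fix s assume s: "s \<in> {0..L}"
    show "continuous (at s within {0..L}) P"
    proof (cases "sin (w * (s - c)) = 0")
      case False
      have "continuous (at s within {0..L}) h"
        using h s by (simp add: continuous_on_eq_continuous_within)
      then show ?thesis
        unfolding P_def[abs_def] cot_def by (intro continuous_intros) (use False in auto)
    next
      case True
      then obtain k :: int where k: "s = c + of_int k * (L/2)" using zero by blast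
      have cot: "cot (w * (t - c)) = cot (w * (t - s))" for t
      proof -
        have "w * (t - c) = w * (t - s) + of_int k * pi"
          using L by (simp add: k w_def field_simps)
        then show ?thesis by (simp add: cot_int_pi_shift)
      qed
      have "((\<lambda>t. w * B\<^sup>2 * \<bar>(t - s)\<^sup>2 * cot (w * (t - s))\<bar>) \<longlongrightarrow> w * B\<^sup>2 * \<bar>0\<bar>) (at s)"
      proof (intro tendsto_mult tendsto_const tendsto_rabs)
        show "((\<lambda>t. (t - s)\<^sup>2 * cot (w * (t - s))) \<longlongrightarrow> 0) (at s)"
          using LIM_offset[OF square_mult_cot_tendsto_0[OF w], of "- s"] by simp
      qed
      then have lim: "((\<lambda>t. w * B\<^sup>2 * \<bar>(t - s)\<^sup>2 * cot (w * (t - s))\<bar>) \<longlongrightarrow> 0) (at s within {0..L})"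
        using Lim_at_imp_Lim_at_within by fastforce
      \<comment> \<open>Since h vanishes at the pole s and is Lipschitz with constant B, its square
        is at most B^2 (t - s)^2, which beats the pole. The limit 0 matches the value of P at
        s.\<close>
      have "(P \<longlongrightarrow> 0) (at s within {0..L})"
      proof (rule Lim_null_comparison[OF _ lim])
        have "norm (P t) \<le> w * B\<^sup>2 * \<bar>(t - s)\<^sup>2 * cot (w * (t - s))\<bar>" if "t \<in> {0..L}" for t
        proof -
          have "\<bar>h t\<bar> \<le> B * \<bar>t - s\<bar>" using lip[OF that s] h0[OF True s] by simp
          then have "\<bar>h t\<bar>\<^sup>2 \<le> (B * \<bar>t - s\<bar>)\<^sup>2" by (rule power_mono) simp
          then have "w * (h t)\<^sup>2 * \<bar>cot (w * (t - s))\<bar> \<le> w * (B\<^sup>2 * (t - s)\<^sup>2) * \<bar>cot (w * (t - s))\<bar>"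
            using w by (intro mult_right_mono mult_left_mono) (auto simp: power_mult_distrib)
          then show ?thesis using w by (simp add: P_def cot abs_mult mult_ac)
        qed
        then show "\<forall>\<^sub>F t in at s within {0..L}. norm (P t) \<le> w * B\<^sup>2 * \<bar>(t - s)\<^sup>2 * cot (w * (t - s))\<bar>"
          by (auto simp: eventually_at_filter)
      qed
      moreover have "P s = 0" using h0[OF True s] by (simp add: P_def)
      ultimately show ?thesis by (simp add: continuous_within)
    qed
  qed
  let ?R = "\<lambda>s. (r s)\<^sup>2 - w\<^sup>2 * (h s)\<^sup>2"
  \<comment> \<open>Away from the poles the derivative of D is the square (r - w h cot)^2, so D
    cannot decrease. As P agrees at 0 and L, D L - D 0 is the integral to be shown
    nonnegative.\<close>
  define D where "D s = integral {0..s} ?R - P s" for s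
  have R: "continuous_on {0..L} ?R" by (intro continuous_intros r h)
  have contD: "continuous_on {0..L} D"
    unfolding D_def[abs_def]
    by (intro continuous_on_diff contP indefinite_integral_continuous_1 integrable_continuous_real R)
  have derD: "\<exists>y. (D has_real_derivative y) (at s) \<and> y \<ge> 0" if s: "s \<in> {0<..<L}" and nz: "sin (w * (s - c)) \<noteq> 0" for s
  proof (intro exI conjI)
    have "((\<lambda>x. integral {0..x} ?R) has_real_derivative ?R s) (at s within {0..L})"
      by (rule integral_has_real_derivative[OF R]) (use s in auto)
    moreover have "at s within {0..L} = at s"
      using s by (intro at_within_interior) (simp add: interior_atLeastAtMost_real)
    ultimately have I: "((\<lambda>x. integral {0..x} ?R) has_real_derivative ?R s) (at s)" by simp
    have "((\<lambda>s. w * (s - c)) has_real_derivative w) (at s)"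
      by (auto intro!: derivative_eq_intros)
    then have cot': "((\<lambda>s. cot (w * (s - c))) has_real_derivative - inverse ((sin (w * (s - c)))\<^sup>2) * w) (at s)"
      by (rule DERIV_chain2[of cot, rotated]) (rule DERIV_cot[OF nz])
    have hh: "((\<lambda>s. w * (h s)\<^sup>2) has_real_derivative 2 * w * h s * r s) (at s)"
      by (auto intro!: derivative_eq_intros h'[OF s])
    show "(D has_real_derivative ?R s - (2 * w * h s * r s * cot (w * (s - c))
        - w\<^sup>2 * (h s)\<^sup>2 * inverse ((sin (w * (s - c)))\<^sup>2))) (at s)"
      unfolding D_def[abs_def] P_def[abs_def]
      using DERIV_diff[OF I DERIV_mult[OF hh cot']] by (simp add: power2_eq_square algebra_simps)
    have "inverse ((sin (w * (s - c)))\<^sup>2) = 1 + (cot (w * (s - c)))\<^sup>2"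
      using nz sin_cos_squared_add[of "w * (s - c)"] by (simp add: cot_def field_simps)
    then have "?R s - (2 * w * h s * r s * cot (w * (s - c))
        - w\<^sup>2 * (h s)\<^sup>2 * inverse ((sin (w * (s - c)))\<^sup>2)) = (r s - w * h s * cot (w * (s - c)))\<^sup>2"
      by (simp add: power2_eq_square algebra_simps)
    then show "?R s - (2 * w * h s * r s * cot (w * (s - c))
        - w\<^sup>2 * (h s)\<^sup>2 * inverse ((sin (w * (s - c)))\<^sup>2)) \<ge> 0" by simp
  qed
  \<comment> \<open>Consecutive poles are L/2 apart. Clipped to [0,L], the gaps for k = -1, 0, 1 are
    [0,c], [c, c + L/2] and [c + L/2, L], on whose interiors sin has no zero.\<close>
  have mono: "D (max 0 (c + of_int k * (L/2))) \<le> D (min L (c + of_int (k + 1) * (L/2)))"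
    if "max 0 (c + of_int k * (L/2)) \<le> min L (c + of_int (k + 1) * (L/2))" for k
  proof (rule DERIV_nonneg_imp_increasing_open[OF that])
    fix x assume x: "max 0 (c + of_int k * (L/2)) < x" "x < min L (c + of_int (k + 1) * (L/2))"
    have "sin (w * (x - c)) \<noteq> 0"
    proof
      assume "sin (w * (x - c)) = 0"
      then obtain j :: int where j: "x = c + of_int j * (L/2)" using zero by blast
      then have "of_int k * (L/2) < of_int j * (L/2)" "of_int j * (L/2) < of_int (k+1) * (L/2)"
        using x by auto
      then have "k < j" "j < k + 1" using L by (auto simp: mult_less_cancel_right simp del: of_int_add)
      then show False by simp
    qed
    then show "\<exists>y. (D has_real_derivative y) (at x) \<and> 0 \<le> y"
      using derD[of x] x by auto
  next
    show "continuous_on {max 0 (c + of_int k * (L/2))..min L (c + of_int (k + 1) * (L/2))} D"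
      by (rule continuous_on_subset[OF contD]) auto
  qed
  have "max 0 (c + of_int (-1) * (L/2)) = 0" "min L (c + of_int (-1 + 1) * (L/2)) = c"
    using c L by (simp_all add: max_absorb1 min_absorb2)
  with mono[of "-1"] c have D1: "D 0 \<le> D c" by simp
  have "max 0 (c + of_int 0 * (L/2)) = c" "min L (c + of_int (0 + 1) * (L/2)) = c + L/2"
    using c L by (simp_all add: max_absorb2 min_absorb2)
  with mono[of 0] L have D2: "D c \<le> D (c + L/2)" by simp
  have "max 0 (c + of_int 1 * (L/2)) = c + L/2" "min L (c + of_int (1 + 1) * (L/2)) = L"
    using c L by (simp_all add: max_absorb2 min_absorb1)
  with mono[of 1] c have D3: "D (c + L/2) \<le> D L" by simp
  have "D 0 \<le> D L" using D1 D2 D3 by linarith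
  moreover have "P L = P 0"
  proof -
    have "w * (L - c) = w * (0 - c) + of_int 2 * pi" using L by (simp add: w_def field_simps)
    then have "cot (w * (L - c)) = cot (w * (0 - c))" by (simp only: cot_int_pi_shift)
    then show ?thesis by (simp add: P_def hper)
  qed
  ultimately have "0 \<le> integral {0..L} ?R" by (simp add: D_def)
  moreover have "integral {0..L} ?R
     = integral {0..L} (\<lambda>s. (r s)\<^sup>2) - w\<^sup>2 * integral {0..L} (\<lambda>s. (h s)\<^sup>2)"
    by (intro integral_unique has_integral_diff has_integral_mult_right integrable_integral
         integrable_continuous_real continuous_intros r h)
  \<comment> \<open>The mixed term disappears because f has mean zero, so replacing f by h = f - a
    only enlarges the integral of the square.\<close>
  moreover have "integral {0..L} (\<lambda>s. (h s)\<^sup>2)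
     = integral {0..L} (\<lambda>s. (f s)\<^sup>2) - 2 * a * integral {0..L} f + a\<^sup>2 * L"
  proof -
    have "((\<lambda>s. (f s)\<^sup>2 - 2 * a * f s + a\<^sup>2) has_integral
        integral {0..L} (\<lambda>s. (f s)\<^sup>2) - 2 * a * integral {0..L} f + a\<^sup>2 * L) {0..L}"
      using has_integral_const_real[of "a\<^sup>2" 0 L] L
      by (intro has_integral_add has_integral_diff has_integral_mult_right integrable_integral
         integrable_continuous_real continuous_intros f) (simp_all add: mult.commute)
    moreover have "(h s)\<^sup>2 = (f s)\<^sup>2 - 2 * a * f s + a\<^sup>2" for s
      by (simp add: h_def power2_eq_square algebra_simps)
    ultimately show ?thesis by (simp add: integral_unique)
  qed
  moreover have "w\<^sup>2 * (a\<^sup>2 * L) \<ge> 0" using L by simp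
  ultimately show ?thesis
    unfolding w_def[symmetric] using mean by (simp add: algebra_simps)
qed

section \<open>Closed elasticae\<close>

text \<open>Rotating the vector (p,k) and rotating it back, and the invariance of its length. With c
  and s free these are polynomial identities; substituting cosine and sine turns the last factor
  into 1.\<close>

lemma rotation_identities:
  fixes p k c s :: real
  shows "(p * c - k * s) * c + (p * s + k * c) * s = p * (c\<^sup>2 + s\<^sup>2)"
    and "- (p * c - k * s) * s + (p * s + k * c) * c = k * (c\<^sup>2 + s\<^sup>2)"
    and "(p * c + k * s)\<^sup>2 + (- p * s + k * c)\<^sup>2 = (p\<^sup>2 + k\<^sup>2) * (c\<^sup>2 + s\<^sup>2)"
  by algebra+

text \<open>Gronwall's argument in both directions from the zero \<open>s0\<close>: to its left
  \<open>y s * exp (C * s)\<close> is nondecreasing, to its right \<open>y s * exp (- C * s)\<close>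
  is nonincreasing, and either way y is at most 0.\<close>

lemma eq_zero_of_gronwall:
  fixes y :: "real \<Rightarrow> real"
  assumes y: "continuous_on {a..b} y" "\<And>s. s \<in> {a..b} \<Longrightarrow> y s \<ge> 0"
    and y': "\<And>s. s \<in> {a<..<b} \<Longrightarrow> \<exists>d. (y has_real_derivative d) (at s) \<and> \<bar>d\<bar> \<le> C * y s"
    and s0: "s0 \<in> {a..b}" "y s0 = 0" and s: "s \<in> {a..b}"
  shows "y s = 0"
proof (cases "s \<le> s0")
  case True
  have "y s * exp (C * s) \<le> y s0 * exp (C * s0)"
  proof (rule DERIV_nonneg_imp_increasing_open[OF True])
    fix x assume "s < x" "x < s0"
    then obtain d where d: "(y has_real_derivative d) (at x)" "\<bar>d\<bar> \<le> C * y x" using y'[of x] s s0 by auto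
    have "((\<lambda>s. y s * exp (C * s)) has_real_derivative (d + C * y x) * exp (C * x)) (at x)"
      using d(1) by (auto intro!: derivative_eq_intros simp: algebra_simps)
    moreover have "(d + C * y x) * exp (C * x) \<ge> 0" using d(2) by simp
    ultimately show "\<exists>z. ((\<lambda>s. y s * exp (C * s)) has_real_derivative z) (at x) \<and> 0 \<le> z" by blast
  next
    show "continuous_on {s..s0} (\<lambda>s. y s * exp (C * s))"
      by (intro continuous_intros continuous_on_subset[OF y(1)]) (use s s0 in auto)
  qed
  then show ?thesis using s0 y(2)[OF s] by (simp add: mult_le_0_iff)
next
  case False
  then have "s0 \<le> s" by simp
  have "- (y s0 * exp (- C * s0)) \<le> - (y s * exp (- C * s))"
  proof (rule DERIV_nonneg_imp_increasing_open[OF \<open>s0 \<le> s\<close>])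
    fix x assume "s0 < x" "x < s"
    then obtain d where d: "(y has_real_derivative d) (at x)" "\<bar>d\<bar> \<le> C * y x" using y'[of x] s s0 by auto
    have "((\<lambda>s. - (y s * exp (- C * s))) has_real_derivative (C * y x - d) * exp (- C * x)) (at x)"
      using d(1) by (auto intro!: derivative_eq_intros simp: algebra_simps)
    moreover have "(C * y x - d) * exp (- C * x) \<ge> 0" using d(2) by simp
    ultimately show "\<exists>z. ((\<lambda>s. - (y s * exp (- C * s))) has_real_derivative z) (at x) \<and> 0 \<le> z" by blast
  next
    show "continuous_on {s0..s} (\<lambda>s. - (y s * exp (- C * s)))"
      by (intro continuous_intros continuous_on_subset[OF y(1)]) (use s s0 in auto)
  qed
  then show ?thesis using s0 y(2)[OF s] by (simp add: mult_le_0_iff)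
qed

text \<open>In polar form the expression is R cos (\<theta> - t), with minimum -R at t + pi modulo 2
  pi. A continuous angle that covers an interval of length 2 pi meets this residue class.\<close>

lemma exists_opposite_angle:
  fixes \<theta> :: "real \<Rightarrow> real"
  assumes \<theta>: "continuous_on {a..b} \<theta>" "a \<le> b" and turn: "\<bar>\<theta> b - \<theta> a\<bar> \<ge> 2 * pi"
  obtains s where "s \<in> {a..b}" "A * cos (\<theta> s) + B * sin (\<theta> s) = - sqrt (A\<^sup>2 + B\<^sup>2)"
proof -
  define R where "R = sqrt (A\<^sup>2 + B\<^sup>2)"
  obtain t where t: "A = R * cos t" "B = R * sin t"
  proof -
    have "Complex A B = rcis (cmod (Complex A B)) (Arg (Complex A B))"
      by (simp add: rcis_cmod_Arg)
    then have "A = sqrt (A\<^sup>2 + B\<^sup>2) * cos (Arg (Complex A B)) \<and> B = sqrt (A\<^sup>2 + B\<^sup>2) * sin (Arg (Complex A B))"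
      by (simp add: complex_eq_iff cmod_def)
    then show thesis using that unfolding R_def by blast
  qed
  define lo where "lo = min (\<theta> a) (\<theta> b)"
  \<comment> \<open>The least integer that lifts t + pi + 2 pi n to at least the smaller end value
    of \<theta>; the result then lies at most 2 pi above it.\<close>
  define n where "n = \<lceil>(lo - (t + pi)) / (2 * pi)\<rceil>"
  define v where "v = t + pi + 2 * pi * of_int n"
  have "lo \<le> v" "v \<le> lo + 2 * pi"
  proof -
    have "(lo - (t + pi)) / (2 * pi) \<le> of_int n" "of_int n < (lo - (t + pi)) / (2 * pi) + 1"
      unfolding n_def by linarith+
    then show "lo \<le> v" "v \<le> lo + 2 * pi" unfolding v_def by (auto simp: field_simps)
  qed
  then have "\<theta> a \<le> v \<and> v \<le> \<theta> b \<or> \<theta> b \<le> v \<and> v \<le> \<theta> a"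
    using turn unfolding lo_def by (auto simp: min_def abs_if split: if_splits)
  then obtain s where s: "s \<in> {a..b}" "\<theta> s = v"
    using IVT'[of \<theta> a v b] IVT2'[of \<theta> b v a] \<theta> by auto
  have "cos v = - cos t" "sin v = - sin t"
    unfolding v_def using cos_int_2pin[of n] sin_int_2pin[of n] by (simp_all add: cos_add sin_add)
  then have "A * cos v + B * sin v = - (A * cos t + B * sin t)" by simp
  also have "A * cos t + B * sin t = R * ((cos t)\<^sup>2 + (sin t)\<^sup>2)"
    unfolding t by algebra
  finally show thesis using that s by (simp add: R_def)
qed

text \<open>
  The force \<open>(\<kappa>\<^sup>2/2 - l) T + \<kappa>' N\<close> is conserved along an elastica with tangent \<open>T\<close> and normal \<open>N\<close>;
  \<open>A\<close> and \<open>B\<close> are its components.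
\<close>
lemma elastica_first_integrals:
  fixes \<theta> \<kappa> :: "real \<Rightarrow> real"
  assumes \<theta>: "\<And>s. s \<in> {0<..<L} \<Longrightarrow> (\<theta> has_real_derivative \<kappa> s) (at s)"
    and \<kappa>: "\<And>s. s \<in> {0<..<L} \<Longrightarrow> (\<kappa> has_real_derivative \<kappa>' s) (at s)"
    and \<kappa>': "\<And>s. s \<in> {0<..<L} \<Longrightarrow> (\<kappa>' has_real_derivative l * \<kappa> s - 1/2 * (\<kappa> s)^3) (at s)"
  shows "\<exists>A B. \<forall>s\<in>{0<..<L}. (\<kappa> s)\<^sup>2 / 2 - l = A * cos (\<theta> s) + B * sin (\<theta> s)
    \<and> \<kappa>' s = - A * sin (\<theta> s) + B * cos (\<theta> s)"
proof -
  let ?p = "\<lambda>s. (\<kappa> s)\<^sup>2 / 2 - l"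
  let ?A = "\<lambda>s. ?p s * cos (\<theta> s) - \<kappa>' s * sin (\<theta> s)" and ?B = "\<lambda>s. ?p s * sin (\<theta> s) + \<kappa>' s * cos (\<theta> s)"
  have A': "(?A has_real_derivative 0) (at s within {0<..<L})"
    and B': "(?B has_real_derivative 0) (at s within {0<..<L})" if s: "s \<in> {0<..<L}" for s
  proof -
    have p: "(?p has_real_derivative \<kappa> s * \<kappa>' s) (at s)"
      using \<kappa>[OF s] by (auto intro!: derivative_eq_intros)
    have "(?A has_real_derivative (\<kappa> s * \<kappa>' s) * cos (\<theta> s) + (- sin (\<theta> s) * \<kappa> s) * ?p s
      - ((l * \<kappa> s - 1/2 * (\<kappa> s)^3) * sin (\<theta> s) + (cos (\<theta> s) * \<kappa> s) * \<kappa>' s)) (at s)"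
      by (intro DERIV_diff DERIV_mult p \<kappa>'[OF s] DERIV_fun_cos[OF \<theta>[OF s]] DERIV_fun_sin[OF \<theta>[OF s]])
    then show "(?A has_real_derivative 0) (at s within {0<..<L})"
      by (auto intro: has_field_derivative_at_within simp: algebra_simps power2_eq_square power3_eq_cube)
    have "(?B has_real_derivative (\<kappa> s * \<kappa>' s) * sin (\<theta> s) + (cos (\<theta> s) * \<kappa> s) * ?p s
      + ((l * \<kappa> s - 1/2 * (\<kappa> s)^3) * cos (\<theta> s) + (- sin (\<theta> s) * \<kappa> s) * \<kappa>' s)) (at s)"
      by (intro DERIV_add DERIV_mult p \<kappa>'[OF s] DERIV_fun_cos[OF \<theta>[OF s]] DERIV_fun_sin[OF \<theta>[OF s]])
    then show "(?B has_real_derivative 0) (at s within {0<..<L})"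
      by (auto intro: has_field_derivative_at_within simp: algebra_simps power2_eq_square power3_eq_cube)
  qed
  obtain A where A: "\<And>s. s \<in> {0<..<L} \<Longrightarrow> ?A s = A"
    using has_field_derivative_zero_constant[OF _ A'] by (metis convex_real_interval(8))
  obtain B where B: "\<And>s. s \<in> {0<..<L} \<Longrightarrow> ?B s = B"
    using has_field_derivative_zero_constant[OF _ B'] by (metis convex_real_interval(8))
  show ?thesis
  proof (intro exI ballI conjI)
    fix s assume s: "s \<in> {0<..<L}"
    show "?p s = A * cos (\<theta> s) + B * sin (\<theta> s)"
      using rotation_identities(1)[of "?p s" "cos (\<theta> s)" "\<kappa>' s" "sin (\<theta> s)"] A[OF s] B[OF s] by simp
    show "\<kappa>' s = - A * sin (\<theta> s) + B * cos (\<theta> s)"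
      using rotation_identities(2)[of "?p s" "cos (\<theta> s)" "\<kappa>' s" "sin (\<theta> s)"] A[OF s] B[OF s] by simp
  qed
qed

text \<open>
  If \<open>K\<close> has no zero, integrating \<open>(K'/K)' = - p - (K'/K)\<^sup>2\<close> with \<open>p = A cos \<theta> + B sin \<theta>\<close> over a
  period forces \<open>K' = 0\<close>. A zero of \<open>K\<close> can only occur where the force is antiparallel to the
  tangent, that is on the separatrix of the pendulum equation, and then \<open>K = 0\<close> throughout.
\<close>
lemma closed_turning_elastica_is_circle:
  fixes \<theta> K :: "real \<Rightarrow> real"
  assumes L: "L > 0" and \<theta>: "continuous_on {0..L} \<theta>" and K: "continuous_on {0..L} K"
    and \<theta>': "\<And>s. s \<in> {0<..<L} \<Longrightarrow> (\<theta> has_real_derivative K s) (at s)"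
    and K': "\<And>s. s \<in> {0<..<L} \<Longrightarrow> (K has_real_derivative - A * sin (\<theta> s) + B * cos (\<theta> s)) (at s)"
    and energy: "\<And>s. s \<in> {0..L} \<Longrightarrow> (K s)\<^sup>2 / 2 - l = A * cos (\<theta> s) + B * sin (\<theta> s)"
    and turn: "\<bar>\<theta> L - \<theta> 0\<bar> \<ge> 2 * pi"
    and Kper: "K L = K 0"
    and per: "cos (\<theta> L) = cos (\<theta> 0)" "sin (\<theta> L) = sin (\<theta> 0)"
    and closed: "integral {0..L} (\<lambda>s. cos (\<theta> s)) = 0" "integral {0..L} (\<lambda>s. sin (\<theta> s)) = 0"
    and s: "s \<in> {0..L}"
  shows "K s = (\<theta> L - \<theta> 0) / L"
proof -
  define p where "p s = A * cos (\<theta> s) + B * sin (\<theta> s)" for s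
  define m where "m s = - A * sin (\<theta> s) + B * cos (\<theta> s)" for s
  define F where "F = sqrt (A\<^sup>2 + B\<^sup>2)"
  have pm: "(p s)\<^sup>2 + (m s)\<^sup>2 = F\<^sup>2" for s
    using rotation_identities(3)[of A "cos (\<theta> s)" B "sin (\<theta> s)"] by (simp add: p_def m_def F_def)
  have F: "F \<ge> 0" by (simp add: F_def)
  have p_le: "\<bar>p s\<bar> \<le> F" for s
    by (rule power2_le_imp_le[OF _ F]) (use pm[of s] in \<open>simp flip: pm[of s]\<close>)
  have cp: "continuous_on {0..L} p" and cm: "continuous_on {0..L} m"
    unfolding p_def[abs_def] m_def[abs_def] by (intro continuous_intros \<theta>)+
  have K'm: "(K has_real_derivative m s) (at s)" if "s \<in> {0<..<L}" for s
    using K'[OF that] by (simp add: m_def)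
  have e: "(K s)\<^sup>2 / 2 = l + p s" if "s \<in> {0..L}" for s
    using energy[OF that] by (simp add: p_def)
  obtain s1 where s1: "s1 \<in> {0..L}" "p s1 = - F"
    using exists_opposite_angle[OF \<theta> _ turn, of A B] L unfolding p_def F_def by (metis less_imp_le)
  \<comment> \<open>Where the force opposes the tangent, the energy identity reads K^2/2 = l -
    F.\<close>
  have lF: "l \<ge> F" using e[OF s1(1)] s1(2) zero_le_power2[of "K s1"] by linarith
  have nz: "K s \<noteq> 0" if s: "s \<in> {0..L}" for s
  proof
    assume "K s = 0"
    then have "l + p s = 0" using e[OF s] by simp
    then have l: "l = F" using lF p_le[of s] by linarith
    \<comment> \<open>For l = F the energy identity is K^2/2 = F + p, so m^2 = (F - p)(F + p) is at
      most F K^2. Hence K^2 has derivative 2 K m bounded by 2 sqrt F times K^2, and Gronwall spreads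
      the zero over the whole interval. Then \<theta> would be constant, against the
      turning.\<close>
    have "(K t)\<^sup>2 = 0" if "t \<in> {0..L}" for t
    proof (rule eq_zero_of_gronwall[where y = "\<lambda>t. (K t)\<^sup>2" and s = t and a = 0 and b = L and C = "2 * sqrt F" and s0 = s])
      show "continuous_on {0..L} (\<lambda>t. (K t)\<^sup>2)" by (intro continuous_intros K)
      show "\<exists>d. ((\<lambda>t. (K t)\<^sup>2) has_real_derivative d) (at t) \<and> \<bar>d\<bar> \<le> 2 * sqrt F * (K t)\<^sup>2"
        if t: "t \<in> {0<..<L}" for t
      proof (intro exI conjI)
        show "((\<lambda>t. (K t)\<^sup>2) has_real_derivative 2 * K t * m t) (at t)"
          using K'm[OF t] by (auto intro!: derivative_eq_intros)
        have "(m t)\<^sup>2 = (F - p t) * (F + p t)"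
          using pm[of t] by (simp add: power2_eq_square algebra_simps)
        also have "F + p t = (K t)\<^sup>2 / 2" using e[of t] l t by simp
        also have "(F - p t) * ((K t)\<^sup>2 / 2) \<le> (2 * F) * ((K t)\<^sup>2 / 2)"
          using p_le[of t] by (intro mult_right_mono) auto
        also have "\<dots> = (sqrt F * \<bar>K t\<bar>)\<^sup>2" using F by (simp add: power_mult_distrib)
        finally have "\<bar>m t\<bar>\<^sup>2 \<le> (sqrt F * \<bar>K t\<bar>)\<^sup>2" by (simp only: power2_abs)
        then have "\<bar>m t\<bar> \<le> sqrt F * \<bar>K t\<bar>"
          by (rule power2_le_imp_le) (simp add: F)
        then have "\<bar>K t\<bar> * \<bar>m t\<bar> \<le> \<bar>K t\<bar> * (sqrt F * \<bar>K t\<bar>)" by (intro mult_left_mono) auto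
        then show "\<bar>2 * K t * m t\<bar> \<le> 2 * sqrt F * (K t)\<^sup>2"
          by (simp add: abs_mult power2_eq_square mult_ac)
      qed
    qed (use s that \<open>K s = 0\<close> in auto)
    then have "\<theta> L = \<theta> 0"
      by (intro DERIV_isconst2[where a = 0 and b = L]) (use \<theta> \<theta>' L in force)+
    then show False using turn pi_gt_zero by simp
  qed
  have "((\<lambda>s. - p s - (m s / K s)\<^sup>2) has_integral m L / K L - m 0 / K 0) {0..L}"
  proof (rule fundamental_theorem_of_calculus_interior)
    show "continuous_on {0..L} (\<lambda>s. m s / K s)"
      by (intro continuous_intros cm K) (use nz in auto)
    fix s assume s: "s \<in> {0<..<L}"
    have "(m has_real_derivative - p s * K s) (at s)"
      unfolding m_def[abs_def] p_def
      by (auto intro!: derivative_eq_intros \<theta>'[OF s] simp: algebra_simps)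
    then have "((\<lambda>s. m s / K s) has_real_derivative (- p s * K s * K s - m s * m s) / (K s * K s)) (at s)"
      using nz[of s] s by (intro DERIV_divide K'm) auto
    also have "(- p s * K s * K s - m s * m s) / (K s * K s) = - p s - (m s / K s)\<^sup>2"
      using nz[of s] s by (simp add: field_simps power2_eq_square)
    finally show "((\<lambda>s. m s / K s) has_vector_derivative - p s - (m s / K s)\<^sup>2) (at s)"
      by (simp add: has_real_derivative_iff_has_vector_derivative)
  qed (use L in auto)
  moreover have "m L = m 0" by (simp add: m_def per)
  ultimately have "((\<lambda>s. - p s - (m s / K s)\<^sup>2) has_integral 0) {0..L}" using Kper by simp
  \<comment> \<open>Closedness makes p integrate to 0, so only the integral of (m/K)^2 survives, and
    it vanishes.\<close>
  moreover have "(p has_integral A * integral {0..L} (\<lambda>s. cos (\<theta> s)) + B * integral {0..L} (\<lambda>s. sin (\<theta> s))) {0..L}"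
    unfolding p_def[abs_def]
    by (intro has_integral_add has_integral_mult_right integrable_integral integrable_continuous_real
        continuous_on_cos continuous_on_sin \<theta>)
  ultimately have "((\<lambda>s. - (- p s - (m s / K s)\<^sup>2) - p s) has_integral - 0 - 0) {0..L}"
    unfolding closed by (intro has_integral_diff has_integral_neg) simp_all
  then have "integral {0..L} (\<lambda>s. (m s / K s)\<^sup>2) = 0" by (simp add: integral_unique)
  then have "\<forall>s\<in>{0..L}. (m s / K s)\<^sup>2 = 0"
    by (subst (asm) integral_eq_0_iff) (use L nz in \<open>auto intro!: continuous_intros cm K\<close>)
  then have m0: "m s = 0" if "s \<in> {0..L}" for s using nz that by simp
  have Kc: "K s = K 0" if "s \<in> {0..L}" for s
    by (rule DERIV_isconst2[where a=0 and b=L]) (use K'm m0 K L that in auto)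
  have "(K has_integral \<theta> L - \<theta> 0) {0..L}"
    by (rule fundamental_theorem_of_calculus_interior)
       (use L \<theta> \<theta>' in \<open>auto simp flip: has_real_derivative_iff_has_vector_derivative\<close>)
  moreover have "(K has_integral L * K 0) {0..L}"
  proof (rule has_integral_eq)
    show "((\<lambda>s. K 0) has_integral L * K 0) {0..L}"
      using has_integral_const_real[of "K 0" 0 L] L by simp
  qed (rule Kc[symmetric])
  ultimately have "\<theta> L - \<theta> 0 = L * K 0" by (rule has_integral_unique)
  then show ?thesis using Kc[OF s] L by simp
qed

lemma elastica_weak_deriv_constant:
  assumes L: "L > 0" and \<theta>: "continuous_on {0..L} \<theta>" and el: "elastica L \<theta>"
    and turn: "\<theta> L - \<theta> 0 = 2 * pi * of_int \<omega>" and \<omega>: "\<omega> \<noteq> 0"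
    and closed: "integral {0..L} (\<lambda>s. cos (\<theta> s)) = 0" "integral {0..L} (\<lambda>s. sin (\<theta> s)) = 0"
  shows "has_weak_deriv L \<theta> (\<lambda>_. 2 * pi * of_int \<omega> / L)"
proof -
  obtain \<kappa> l where w: "has_weak_deriv L \<theta> \<kappa>" and sm: "smooth_on {0<..<L} \<kappa>"
    and ode: "\<And>s. s \<in> {0<..<L} \<Longrightarrow> deriv (deriv \<kappa>) s + 1/2 * (\<kappa> s)^3 - l * \<kappa> s = 0"
    using el unfolding elastica_def by blast
  have \<kappa>': "(\<kappa> has_real_derivative deriv \<kappa> s) (at s)" if "s \<in> {0<..<L}" for s
    using sm[unfolded smooth_on_def, rule_format, of s 0] that
    by (simp add: DERIV_deriv_iff_real_differentiable)
  have \<kappa>'': "(deriv \<kappa> has_real_derivative l * \<kappa> s - 1/2 * (\<kappa> s)^3) (at s)" if "s \<in> {0<..<L}" for s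
  proof -
    have "(deriv \<kappa> has_real_derivative deriv (deriv \<kappa>) s) (at s)"
      using sm[unfolded smooth_on_def, rule_format, of s 1] that
      by (simp add: DERIV_deriv_iff_real_differentiable)
    moreover have "deriv (deriv \<kappa>) s = l * \<kappa> s - 1/2 * (\<kappa> s)^3" using ode[OF that] by linarith
    ultimately show ?thesis by simp
  qed
  have c\<kappa>: "continuous_on {0<..<L} \<kappa>"
    by (rule DERIV_continuous_on) (rule has_field_derivative_at_within[OF \<kappa>'])
  note \<theta>' = has_weak_deriv_imp_has_real_derivative[OF \<theta> w c\<kappa> L]
  have "\<exists>A B. \<forall>s\<in>{0<..<L}. (\<kappa> s)\<^sup>2 / 2 - l = A * cos (\<theta> s) + B * sin (\<theta> s)
      \<and> deriv \<kappa> s = - A * sin (\<theta> s) + B * cos (\<theta> s)"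
    by (rule elastica_first_integrals[OF \<theta>' \<kappa>' \<kappa>''])
  then obtain A B where "\<forall>s\<in>{0<..<L}. (\<kappa> s)\<^sup>2 / 2 - l = A * cos (\<theta> s) + B * sin (\<theta> s)
      \<and> deriv \<kappa> s = - A * sin (\<theta> s) + B * cos (\<theta> s)"
    by (elim exE)
  then have AB: "(\<kappa> s)\<^sup>2 / 2 - l = A * cos (\<theta> s) + B * sin (\<theta> s)"
    "deriv \<kappa> s = - A * sin (\<theta> s) + B * cos (\<theta> s)" if "s \<in> {0<..<L}" for s
    using that by simp_all
  let ?m = "\<lambda>s. - A * sin (\<theta> s) + B * cos (\<theta> s)"
  let ?M = "\<lambda>s. integral {0..s} ?m"
  have m: "continuous_on {0..L} ?m" by (intro continuous_intros \<theta>)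
  have M: "continuous_on {0..L} ?M"
    by (intro indefinite_integral_continuous_1 integrable_continuous_real m)
  have M': "(?M has_real_derivative ?m s) (at s)" if s: "s \<in> {0<..<L}" for s
  proof -
    have "(?M has_real_derivative ?m s) (at s within {0..L})"
      by (rule integral_has_real_derivative[OF m]) (use s in auto)
    moreover have "at s within {0..L} = at s"
      using s by (intro at_within_interior) (simp add: interior_atLeastAtMost_real)
    ultimately show ?thesis by simp
  qed
  have "((\<lambda>s. \<kappa> s - ?M s) has_real_derivative 0) (at s within {0<..<L})" if s: "s \<in> {0<..<L}" for s
    using DERIV_diff[OF \<kappa>'[OF s] M'[OF s]] AB(2)[OF s] by (simp add: has_field_derivative_at_within)
  then have "\<exists>C. \<forall>s\<in>{0<..<L}. \<kappa> s - ?M s = C"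
    by (intro has_field_derivative_zero_constant convex_real_interval)
  then obtain C where C: "\<forall>s\<in>{0<..<L}. \<kappa> s - ?M s = C" by (elim exE)
  \<comment> \<open>The continuous extension of \<kappa> to [0,L]: inside, its derivative is the
    function \<open>?m\<close>, which is continuous on the closed interval.\<close>
  define K where "K s = ?M s + C" for s
  have K\<kappa>: "K s = \<kappa> s" if "s \<in> {0<..<L}" for s using bspec[OF C that] by (simp add: K_def)
  have K: "continuous_on {0..L} K" unfolding K_def[abs_def] by (intro continuous_on_add M continuous_on_const)
  have K': "(K has_real_derivative ?m s) (at s)" if "s \<in> {0<..<L}" for s
    using DERIV_add[OF M'[OF that] DERIV_const[of C]] by (simp add: K_def[abs_def])
  have energy: "(K s)\<^sup>2 / 2 - l = A * cos (\<theta> s) + B * sin (\<theta> s)" if "s \<in> {0..L}" for s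
  proof -
    have "(K s)\<^sup>2 / 2 - l - (A * cos (\<theta> s) + B * sin (\<theta> s)) = 0"
    proof (rule continuous_constant_on_closure[where S = "{0<..<L}"
          and f = "\<lambda>s. (K s)\<^sup>2 / 2 - l - (A * cos (\<theta> s) + B * sin (\<theta> s))"])
      show "continuous_on (closure {0<..<L}) (\<lambda>s. (K s)\<^sup>2 / 2 - l - (A * cos (\<theta> s) + B * sin (\<theta> s)))"
        using L by (simp add: closure_greaterThanLessThan) (intro continuous_intros K \<theta>; simp)
    qed (use AB(1) K\<kappa> that L in \<open>auto simp: closure_greaterThanLessThan\<close>)
    then show ?thesis by simp
  qed
  have "(?m has_integral - A * integral {0..L} (\<lambda>s. sin (\<theta> s)) + B * integral {0..L} (\<lambda>s. cos (\<theta> s))) {0..L}"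
    by (intro has_integral_add has_integral_mult_right integrable_integral integrable_continuous_real
        continuous_on_cos continuous_on_sin \<theta>)
  then have "?M L = 0" unfolding closed by (simp add: integral_unique)
  then have Kper: "K L = K 0" by (simp add: K_def)
  have big: "\<bar>\<theta> L - \<theta> 0\<bar> \<ge> 2 * pi"
  proof -
    have "\<bar>real_of_int \<omega>\<bar> \<ge> 1" using \<omega> by linarith
    then show ?thesis unfolding turn by (simp add: abs_mult)
  qed
  have "\<theta> L = \<theta> 0 + 2 * pi * of_int \<omega>" using turn by simp
  then have per: "cos (\<theta> L) = cos (\<theta> 0)" "sin (\<theta> L) = sin (\<theta> 0)"
    by (simp_all add: cos_add sin_add)
  have "K s = 2 * pi * of_int \<omega> / L" if "s \<in> {0..L}" for s
  proof -
    have "(\<theta> has_real_derivative K s) (at s)" if "s \<in> {0<..<L}" for s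
      using \<theta>'[OF that] K\<kappa>[OF that] by simp
    from closed_turning_elastica_is_circle[OF L \<theta> K this K' energy big Kper per closed \<open>s \<in> {0..L}\<close>]
    show ?thesis by (simp add: turn)
  qed
  then have "\<kappa> s = 2 * pi * of_int \<omega> / L" if "s \<in> {0<..<L}" for s using K\<kappa>[OF that] that by simp
  then show ?thesis
    using \<theta>' by (intro has_weak_deriv_classical[OF \<theta> _ continuous_imp_L2 L]) (auto intro!: continuous_intros)
qed

section \<open>The Euler--Lagrange equation for the density\<close>

lemma stiffness_slope_bound:
  fixes \<beta> :: "real \<Rightarrow> real" and X :: real
  assumes \<beta>: "\<And>x. \<beta> differentiable (at x)" and \<beta>': "\<And>x. deriv \<beta> differentiable (at x)"
    and "X > 0"
    and H: "convex_on UNIV \<beta>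
       \<or> (\<forall>x. x \<noteq> \<nu> \<longrightarrow> \<bar>deriv \<beta> x\<bar> < X * \<bar>\<nu> - x\<bar>)
       \<or> (SUP x. ereal \<bar>deriv (deriv \<beta>) x\<bar>) < ereal X"
  obtains b where "\<And>x. x \<noteq> \<nu> \<Longrightarrow> 0 < X * (x - \<nu>)\<^sup>2 + (deriv \<beta> x - b) * (x - \<nu>)"
proof -
  \<comment> \<open>A slope deviation smaller than X |x - \<nu>| cannot outweigh the quadratic term,
    whatever its sign. Case (b) uses this with d = \<beta>'(x), case (c) with d = \<beta>'(x) -
    \<beta>'(\<nu>).\<close>
  have *: "0 < X * (x - \<nu>)\<^sup>2 + d * (x - \<nu>)" if "x \<noteq> \<nu>" "\<bar>d\<bar> < X * \<bar>\<nu> - x\<bar>" for x d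
  proof -
    have "\<bar>d\<bar> * \<bar>x - \<nu>\<bar> < (X * \<bar>\<nu> - x\<bar>) * \<bar>x - \<nu>\<bar>"
      using that by (intro mult_strict_right_mono) auto
    also have "\<dots> = X * (x - \<nu>)\<^sup>2"
      using abs_mult_self_eq[of "x - \<nu>"]
      by (simp only: abs_minus_commute[of \<nu> x] power2_eq_square mult.assoc)
    finally have "\<bar>d * (x - \<nu>)\<bar> < X * (x - \<nu>)\<^sup>2" by (simp only: abs_mult)
    then show ?thesis by linarith
  qed
  from H show thesis
  proof (elim disjE)
    assume cv: "convex_on UNIV \<beta>"
    have tan: "\<beta> y - \<beta> x \<ge> deriv \<beta> x * (y - x)" for x y
      by (rule convex_on_imp_above_tangent[OF cv])
         (use \<beta> in \<open>auto simp: DERIV_deriv_iff_real_differentiable\<close>)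
    show thesis
    proof (rule that[of "deriv \<beta> \<nu>"])
      fix x assume "x \<noteq> \<nu>"
      then have "0 < X * (x - \<nu>)\<^sup>2" using \<open>X > 0\<close> by simp
      \<comment> \<open>Adding the tangent inequalities at x and at \<nu> gives monotonicity of
        \<beta>'.\<close>
      moreover have "(deriv \<beta> x - deriv \<beta> \<nu>) * (x - \<nu>) \<ge> 0"
        using tan[of x \<nu>] tan[of \<nu> x] by (simp add: algebra_simps)
      ultimately show "0 < X * (x - \<nu>)\<^sup>2 + (deriv \<beta> x - deriv \<beta> \<nu>) * (x - \<nu>)" by simp
    qed
  next
    assume "\<forall>x. x \<noteq> \<nu> \<longrightarrow> \<bar>deriv \<beta> x\<bar> < X * \<bar>\<nu> - x\<bar>"
    then show thesis using * that[of 0] by simp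
  next
    assume sup: "(SUP x. ereal \<bar>deriv (deriv \<beta>) x\<bar>) < ereal X"
    have d2: "\<bar>deriv (deriv \<beta>) x\<bar> < X" for x
      using order.strict_trans1[OF SUP_upper[of x UNIV "\<lambda>x. ereal \<bar>deriv (deriv \<beta>) x\<bar>"] sup] by simp
    have lt: "\<bar>deriv \<beta> y - deriv \<beta> x\<bar> < X * (y - x)" if "x < y" for x y
    proof -
      obtain z where "deriv \<beta> y - deriv \<beta> x = (y - x) * deriv (deriv \<beta>) z"
        using MVT2[OF \<open>x < y\<close>, of "deriv \<beta>" "deriv (deriv \<beta>)"] \<beta>'
        by (auto simp: DERIV_deriv_iff_real_differentiable)
      then show ?thesis using d2[of z] that by (simp add: abs_mult mult.commute)
    qed
    show thesis
    proof (rule that[of "deriv \<beta> \<nu>"], rule *)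
      show "\<bar>deriv \<beta> x - deriv \<beta> \<nu>\<bar> < X * \<bar>\<nu> - x\<bar>" if "x \<noteq> \<nu>" for x
        using lt[of x \<nu>] lt[of \<nu> x] that
        by (cases x \<nu> rule: linorder_cases) (auto simp: abs_minus_commute)
    qed
  qed
qed

text \<open>Here Q(\<rho>) is the right-hand side of \<mu> \<rho>'' = Q(\<rho>), and the two
  integral hypotheses are the equation tested with 1 and with \<rho>. Strictness is carried by the
  pointwise \<open>bound\<close>, so the non-strict Wirtinger inequality suffices.\<close>

lemma weak_solution_constant:
  fixes \<rho> r :: "real \<Rightarrow> real"
  assumes L: "L > 0" and \<rho>: "continuous_on {0..L} \<rho>" and per: "\<rho> L = \<rho> 0"
    and mean: "integral {0..L} \<rho> = \<nu> * L" and r: "continuous_on {0..L} r"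
    and \<rho>': "\<And>s. s \<in> {0<..<L} \<Longrightarrow> (\<rho> has_real_derivative r s) (at s)"
    and Q: "continuous_on UNIV Q"
    and test1: "integral {0..L} (\<lambda>s. Q (\<rho> s)) = 0"
    and test\<rho>: "integral {0..L} (\<lambda>s. \<mu> * (r s)\<^sup>2 + Q (\<rho> s) * \<rho> s) = 0"
    and \<mu>: "\<mu> > 0"
    and bound: "\<And>x. x \<noteq> \<nu> \<Longrightarrow> 0 < \<mu> * (2 * pi / L)\<^sup>2 * (x - \<nu>)\<^sup>2 + (Q x - b) * (x - \<nu>)"
    and s: "s \<in> {0..L}"
  shows "\<rho> s = \<nu>"
proof -
  \<comment> \<open>\<open>?E\<close> is nonnegative by \<open>bound\<close>, its integral is at
    most 0 by Wirtinger, and so it vanishes identically; by strictness of \<open>bound\<close> this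
    happens only at \<rho> = \<nu>.\<close>
  let ?E = "\<lambda>s. \<mu> * (2 * pi / L)\<^sup>2 * (\<rho> s - \<nu>)\<^sup>2 + (Q (\<rho> s) - b) * (\<rho> s - \<nu>)"
  have cQ: "continuous_on {0..L} (\<lambda>s. Q (\<rho> s))"
    by (rule continuous_on_compose2[OF Q \<rho>]) auto
  have cE: "continuous_on {0..L} ?E" by (intro continuous_intros \<rho> cQ)
  have E0: "?E s \<ge> 0" for s using bound[of "\<rho> s"] by (cases "\<rho> s = \<nu>") auto
  have mean0: "integral {0..L} (\<lambda>s. \<rho> s - \<nu>) = 0"
  proof -
    have "((\<lambda>s. \<rho> s - \<nu>) has_integral integral {0..L} \<rho> - \<nu> * L) {0..L}"
      using has_integral_const_real[of \<nu> 0 L] L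
      by (intro has_integral_diff integrable_integral integrable_continuous_real \<rho>) (simp add: mult.commute)
    then show ?thesis using mean by (simp add: integral_unique)
  qed
  have wirt: "(2 * pi / L)\<^sup>2 * integral {0..L} (\<lambda>s. (\<rho> s - \<nu>)\<^sup>2) \<le> integral {0..L} (\<lambda>s. (r s)\<^sup>2)"
  proof (rule wirtinger_inequality[OF L _ r])
    show "continuous_on {0..L} (\<lambda>s. \<rho> s - \<nu>)" by (intro continuous_intros \<rho>)
    show "((\<lambda>s. \<rho> s - \<nu>) has_real_derivative r s) (at s)" if "s \<in> {0<..<L}" for s
      using DERIV_diff[OF \<rho>'[OF that] DERIV_const[of \<nu>]] by simp
  qed (use per mean0 in auto)
  have "(?E has_integral
      \<mu> * (2 * pi / L)\<^sup>2 * integral {0..L} (\<lambda>s. (\<rho> s - \<nu>)\<^sup>2) + integral {0..L} (\<lambda>s. (Q (\<rho> s) - b) * (\<rho> s - \<nu>))) {0..L}"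
    by (intro has_integral_add has_integral_mult_right integrable_integral integrable_continuous_real
        continuous_intros \<rho> cQ)
  moreover have "integral {0..L} (\<lambda>s. (Q (\<rho> s) - b) * (\<rho> s - \<nu>)) = - \<mu> * integral {0..L} (\<lambda>s. (r s)\<^sup>2)"
  proof -
    have "((\<lambda>s. (\<mu> * (r s)\<^sup>2 + Q (\<rho> s) * \<rho> s) - \<mu> * (r s)\<^sup>2 - \<nu> * Q (\<rho> s) - b * (\<rho> s - \<nu>)) has_integral
        integral {0..L} (\<lambda>s. \<mu> * (r s)\<^sup>2 + Q (\<rho> s) * \<rho> s) - \<mu> * integral {0..L} (\<lambda>s. (r s)\<^sup>2)
        - \<nu> * integral {0..L} (\<lambda>s. Q (\<rho> s)) - b * integral {0..L} (\<lambda>s. \<rho> s - \<nu>)) {0..L}"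
      by (intro has_integral_diff has_integral_mult_right integrable_integral integrable_continuous_real
          continuous_intros \<rho> cQ r)
    moreover have "(\<lambda>s. (\<mu> * (r s)\<^sup>2 + Q (\<rho> s) * \<rho> s) - \<mu> * (r s)\<^sup>2 - \<nu> * Q (\<rho> s) - b * (\<rho> s - \<nu>))
        = (\<lambda>s. (Q (\<rho> s) - b) * (\<rho> s - \<nu>))"
      by (simp add: algebra_simps)
    ultimately show ?thesis using test1 test\<rho> mean0 by (simp add: integral_unique)
  qed
  ultimately have "integral {0..L} ?E = \<mu> * ((2 * pi / L)\<^sup>2 * integral {0..L} (\<lambda>s. (\<rho> s - \<nu>)\<^sup>2)
      - integral {0..L} (\<lambda>s. (r s)\<^sup>2))"
    by (simp add: integral_unique algebra_simps)
  also have "\<dots> \<le> 0" using wirt \<mu> by (simp add: mult_le_0_iff)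
  finally have "integral {0..L} ?E = 0"
    using integral_nonneg[OF integrable_continuous_real[OF cE]] E0 by fastforce
  then have "\<forall>s\<in>{0..L}. ?E s = 0"
    using integral_eq_0_iff[OF cE L] E0 by blast
  then show ?thesis using bound[of "\<rho> s"] s by fastforce
qed

section \<open>Admissible variations and the conclusion\<close>

lemma test_function_W12_per:
  assumes "test_function L \<phi>" "L > 0"
  shows "\<phi> \<in> W12_per L" "has_weak_deriv L \<phi> (deriv \<phi>)"
proof -
  obtain a b where d: "\<And>x. (\<phi> has_real_derivative deriv \<phi> x) (at x)"
    and ab: "0 < a" "b < L" "\<And>s. \<phi> s \<noteq> 0 \<Longrightarrow> a \<le> s \<and> s \<le> b"
    using test_functionE[OF assms] by metis
  note c = test_function_continuous[OF assms(1)]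
  show w: "has_weak_deriv L \<phi> (deriv \<phi>)"
    by (intro has_weak_deriv_classical c d continuous_imp_L2 assms(2))
  have "\<phi> 0 = 0" "\<phi> L = 0" using ab(1,2) ab(3)[of 0] ab(3)[of L] by fastforce+
  then show "\<phi> \<in> W12_per L"
    using w c continuous_imp_L2[OF c(1)] by (auto simp: W12_per_def W12_def)
qed

lemma const_W12_per:
  assumes "L > 0"
  shows "(\<lambda>_. a) \<in> W12_per L" "has_weak_deriv L (\<lambda>_. a) (\<lambda>_. 0)"
proof -
  show w: "has_weak_deriv L (\<lambda>_. a) (\<lambda>_. 0)"
    by (intro has_weak_deriv_classical continuous_imp_L2 assms) auto
  then show "(\<lambda>_. a) \<in> W12_per L"
    using continuous_imp_L2[of L "\<lambda>_. a"] by (auto simp: W12_per_def W12_def)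
qed

theorem lemma2p11:
  fixes L \<nu> \<mu> c0 :: real and \<omega> :: int and \<beta> \<theta> \<rho> :: "real \<Rightarrow> real"
  assumes "L > 0" and "\<mu> > 0"
    and "smooth_on UNIV \<beta>" and "\<And>x. \<beta> x > 0"
    and "\<omega> \<noteq> 0" and "c0 \<noteq> 2 * pi * of_int \<omega> / L"
    and "constrained_critical_point L \<nu> \<mu> \<omega> c0 \<beta> \<theta> \<rho>"
    and "elastica L \<theta>"
    and "convex_on UNIV \<beta>
       \<or> (\<forall>x. x \<noteq> \<nu> \<longrightarrow>
            \<bar>deriv \<beta> x\<bar> < 2 * \<mu> * (2 * pi / (2 * pi * of_int \<omega> - L * c0))\<^sup>2 * \<bar>\<nu> - x\<bar>)
       \<or> (SUP x. ereal \<bar>deriv (deriv \<beta>) x\<bar>)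
            < ereal (2 * \<mu> * (2 * pi / (2 * pi * of_int \<omega> - L * c0))\<^sup>2)"
  shows "\<rho> constant_on {0..L} \<and> homogeneous_elastica L \<theta> \<rho>"
proof -
  note L = assms(1) and \<mu> = assms(2)
  have adm: "(\<theta>, \<rho>) \<in> admissible L \<nu> \<omega>"
    using assms(7) by (simp add: constrained_critical_point_def)
  obtain l1 l2 lr where EL: "\<And>v \<sigma>. v \<in> W12_per L \<Longrightarrow> \<sigma> \<in> W12_per L \<Longrightarrow>
      0 = (LINT s:{0..L}|lebesgue. \<mu> * weak_deriv L \<rho> s * weak_deriv L \<sigma> s
               + 1/2 * deriv \<beta> (\<rho> s) * (weak_deriv L \<theta> s - c0)\<^sup>2 * \<sigma> s + lr * \<sigma> s)"
    using assms(7) unfolding constrained_critical_point_def by blast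
  have \<theta>: "continuous_on {0..L} \<theta>" and \<rho>: "continuous_on {0..L} \<rho>" and \<rho>W: "\<rho> \<in> W12_per L"
    and turn: "\<theta> L - \<theta> 0 = 2 * pi * of_int \<omega>" and per: "\<rho> L = \<rho> 0"
    using adm by (auto simp: admissible_def W12_def W12_per_def)
  have LINT: "(LINT s:{0..L}|lebesgue. f s) = integral {0..L} f" if "continuous_on {0..L} f" for f :: "real \<Rightarrow> real"
    by (intro set_lebesgue_integral_eq_integral(2) absolutely_integrable_continuous_real that)
  have closed: "integral {0..L} (\<lambda>s. cos (\<theta> s)) = 0" "integral {0..L} (\<lambda>s. sin (\<theta> s)) = 0"
    and mean: "integral {0..L} \<rho> = \<nu> * L"
    using adm LINT[OF continuous_on_cos[OF \<theta>]] LINT[OF continuous_on_sin[OF \<theta>]] LINT[OF \<rho>]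
    by (auto simp: admissible_def)
  define k where "k = 2 * pi * of_int \<omega> / L - c0"
  have k: "k \<noteq> 0" using assms(6) by (simp add: k_def)
  have \<theta>k: "negligible {s \<in> {0..L}. weak_deriv L \<theta> s \<noteq> 2 * pi * of_int \<omega> / L}"
    by (intro weak_deriv_eq_AE continuous_imp_L2 \<theta> L elastica_weak_deriv_constant assms(5,8) turn closed)
  have \<beta>: "\<beta> differentiable (at x)" and \<beta>': "deriv \<beta> differentiable (at x)" for x
    using assms(3)[unfolded smooth_on_def, rule_format, of x 0]
      assms(3)[unfolded smooth_on_def, rule_format, of x 1] by auto
  have c\<beta>': "continuous_on UNIV (deriv \<beta>)"
    using \<beta>' by (auto intro!: continuous_at_imp_continuous_on differentiable_imp_continuous_within)
  \<comment> \<open>The multiplier is absorbed into Q, so the equation for the density becomes \<mu>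
    \<rho>'' = Q(\<rho>).\<close>
  define Q where "Q x = 1/2 * deriv \<beta> x * k\<^sup>2 + lr" for x
  have Q: "continuous_on UNIV Q" unfolding Q_def[abs_def] by (intro continuous_intros c\<beta>')
  have q: "continuous_on {0..L} (\<lambda>s. Q (\<rho> s))"
    by (rule continuous_on_compose2[OF Q \<rho>]) auto
  let ?g = "weak_deriv L \<rho>"
  have g: "has_weak_deriv L \<rho> ?g"
    using \<rho>W someI_ex[of "has_weak_deriv L \<rho>"] by (auto simp: W12_per_def W12_def weak_deriv_def)
  then have ig: "?g absolutely_integrable_on {0..L}"
    by (auto simp: has_weak_deriv_def L2_imp_absolutely_integrable)
  \<comment> \<open>The weak derivatives of \<theta> and of the variation are replaced by explicit
    functions; that of \<rho> stays abstract, as its continuity is yet to be derived from this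
    identity.\<close>
  have weak: "integral {0..L} (\<lambda>s. ?g s * (\<mu> * \<tau> s) + Q (\<rho> s) * \<sigma> s) = 0"
    if \<sigma>: "\<sigma> \<in> W12_per L" and \<tau>: "has_weak_deriv L \<sigma> \<tau>" "continuous_on {0..L} \<tau>" for \<sigma> \<tau>
  proof -
    have c\<sigma>: "continuous_on {0..L} \<sigma>" using \<sigma> by (simp add: W12_per_def W12_def)
    have n: "negligible ({s \<in> {0..L}. weak_deriv L \<theta> s \<noteq> 2 * pi * of_int \<omega> / L}
        \<union> {s \<in> {0..L}. weak_deriv L \<sigma> s \<noteq> \<tau> s})"
      by (intro negligible_Un \<theta>k weak_deriv_eq_AE[OF continuous_imp_L2[OF c\<sigma>] \<tau>(1) L])
    have i: "(\<lambda>s. ?g s * (\<mu> * \<tau> s) + Q (\<rho> s) * \<sigma> s) absolutely_integrable_on {0..L}"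
      by (intro set_integral_add(1) absolutely_integrable_mult_continuous ig
          absolutely_integrable_continuous_real continuous_on_mult continuous_on_const \<tau> q c\<sigma>)
    \<comment> \<open>The zero function fills the place of the variation of \<theta>.\<close>
    show ?thesis
      by (rule trans[OF LINT_eq_integral_spike[OF i n, symmetric] EL[OF const_W12_per(1)[OF L, of 0] \<sigma>, symmetric]])
         (auto simp: Q_def k_def algebra_simps)
  qed
  obtain r where r: "continuous_on {0..L} r" "negligible {s \<in> {0..L}. ?g s \<noteq> r s}"
    and \<rho>': "\<And>s. s \<in> {0<..<L} \<Longrightarrow> (\<rho> has_real_derivative r s) (at s)"
  proof (rule weak_solution_regularity[OF \<rho> g _ L])
    show "continuous_on {0..L} (\<lambda>s. Q (\<rho> s) / \<mu>)" by (intro continuous_intros q) (use \<mu> in auto)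
    fix \<phi> assume t: "test_function L \<phi>"
    have "integral {0..L} (\<lambda>s. inverse \<mu> * (?g s * (\<mu> * deriv \<phi> s) + Q (\<rho> s) * \<phi> s)) = 0"
      using weak[OF test_function_W12_per[OF t L] test_function_continuous(2)[OF t]] by simp
    moreover have "(\<lambda>s. inverse \<mu> * (?g s * (\<mu> * deriv \<phi> s) + Q (\<rho> s) * \<phi> s))
       = (\<lambda>s. ?g s * deriv \<phi> s + Q (\<rho> s) / \<mu> * \<phi> s)"
      using \<mu> by (simp add: field_simps)
    ultimately show "integral {0..L} (\<lambda>s. ?g s * deriv \<phi> s + Q (\<rho> s) / \<mu> * \<phi> s) = 0" by simp
  qed blast
  have test1: "integral {0..L} (\<lambda>s. Q (\<rho> s)) = 0"
    using weak[OF const_W12_per[OF L, of 1]] by simp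
  \<comment> \<open>\<rho> is itself a periodic variation, and by now its weak derivative has the
    continuous representative r.\<close>
  have test\<rho>: "integral {0..L} (\<lambda>s. \<mu> * (r s)\<^sup>2 + Q (\<rho> s) * \<rho> s) = 0"
  proof -
    have "integral {0..L} (\<lambda>s. \<mu> * (r s)\<^sup>2 + Q (\<rho> s) * \<rho> s)
      = integral {0..L} (\<lambda>s. ?g s * (\<mu> * r s) + Q (\<rho> s) * \<rho> s)"
      by (rule integral_spike[OF r(2)]) (auto simp: power2_eq_square)
    also have "\<dots> = 0"
      by (rule weak[OF \<rho>W has_weak_deriv_classical[OF \<rho> \<rho>' continuous_imp_L2[OF r(1)] L] r(1)])
    finally show ?thesis .
  qed
  define X where "X = 2 * \<mu> * (2 * pi / (2 * pi * of_int \<omega> - L * c0))\<^sup>2"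
  \<comment> \<open>This turns the threshold X into 2 \<mu> (2 pi / L)^2 / k^2, the form that
    matches Wirtinger's constant after multiplication by k^2/2.\<close>
  have Lk: "2 * pi * of_int \<omega> - L * c0 = L * k" using L by (simp add: k_def field_simps)
  have X: "k\<^sup>2 * X = 2 * \<mu> * (2 * pi / L)\<^sup>2" "X > 0"
    unfolding X_def Lk using k L \<mu> by (auto simp: power_mult_distrib power_divide field_simps)
  obtain b where b: "\<And>x. x \<noteq> \<nu> \<Longrightarrow> 0 < X * (x - \<nu>)\<^sup>2 + (deriv \<beta> x - b) * (x - \<nu>)"
    using stiffness_slope_bound[OF \<beta> \<beta>' X(2)] assms(9)[folded X_def] by blast
  \<comment> \<open>The shift is chosen so that the multiplier cancels: Q x minus it equals k^2/2
    times \<beta>'(x) - b.\<close>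
  have "0 < \<mu> * (2 * pi / L)\<^sup>2 * (x - \<nu>)\<^sup>2 + (Q x - (1/2 * b * k\<^sup>2 + lr)) * (x - \<nu>)" if "x \<noteq> \<nu>" for x
  proof -
    have "0 < k\<^sup>2 / 2 * (X * (x - \<nu>)\<^sup>2 + (deriv \<beta> x - b) * (x - \<nu>))"
      using k b[OF that] by (intro mult_pos_pos) auto
    also have "\<dots> = (k\<^sup>2 * X) / 2 * (x - \<nu>)\<^sup>2 + (Q x - (1/2 * b * k\<^sup>2 + lr)) * (x - \<nu>)"
      by (simp add: Q_def field_simps)
    finally show ?thesis by (simp add: X(1))
  qed
  then have "\<rho> s = \<nu>" if "s \<in> {0..L}" for s
    using weak_solution_constant[OF L \<rho> per mean r(1) \<rho>' Q test1 test\<rho> \<mu> _ that] by blast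
  then have "\<rho> constant_on {0..L}" by (auto simp: constant_on_def)
  then show ?thesis using assms(8) by (simp add: homogeneous_elastica_def)
qed

end
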